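(* The topological group $G:=H_+[0,1]$ is Rosenthal representable; that is, there exist a Rosenthal Banach space $V$ and a topological group embedding $G\hookrightarrow \mathrm{Iso}(V)$, where $\mathrm{Iso}(V)$ carries the strong operator topology.
   Context: $H_+[0,1]$ is the Polish group of all orientation preserving (increasing) homeomorphisms of the unit interval $[0,1]$, with the compact-open topology. $\mathrm{Iso}(V)$ is the group of all linear isometries of the real Banach space $V$ onto itself. The strong operator topology is the topology of pointwise norm convergence on $V$. A Banach space is Rosenthal if it does not contain an isomorphic copy of $l_1$. *)

theory Defs
  imports "HOL-Analysis.Analysis" "HOL-Algebra.Bij"
begin

section \<open>Banach spaces given by a carrier and a norm\<close>

text \<open>
  A Banach space is a linear subspace \<open>V\<close> of some type of class \<^class>\<open>real_vector\<close>,
  together with a complete norm \<open>N\<close> on \<open>V\<close>. The surrounding type supplies the vector space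
  operations only; \<open>N\<close> is unrelated to any norm that type may have, and its values outside
  \<open>V\<close> are irrelevant. A formula cannot quantify over types, but it can quantify over such pairs
  once the surrounding type is fixed.

  Every real vector space of dimension at most the continuum is linearly isomorphic to a subspace
  of the type \<open>real \<Rightarrow>\<^sub>C real\<close>; since \<open>N\<close> is arbitrary, the Banach spaces carried by this type
  are, up to isometric isomorphism, all those of cardinality at most the continuum, in particular
  all separable ones. When a second countable group is represented on an arbitrary Rosenthal space,
  one may pass to the closed linear span of countably many orbits, a separable invariant subspace
  on which the group is still topologically embedded. So for the existence of Rosenthal
  representations of such a group nothing is lost by considering this type only.
\<close>

definition norm_on :: "'a::real_vector set \<Rightarrow> ('a \<Rightarrow> real) \<Rightarrow> bool" where
  "norm_on V N \<longleftrightarrow>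
     (\<forall>x\<in>V. 0 \<le> N x) \<and>
     (\<forall>x\<in>V. N x = 0 \<longleftrightarrow> x = 0) \<and>
     (\<forall>x\<in>V. \<forall>r. N (r *\<^sub>R x) = \<bar>r\<bar> * N x) \<and>
     (\<forall>x\<in>V. \<forall>y\<in>V. N (x + y) \<le> N x + N y)"

text \<open>The value 0 off \<open>V\<close> is needed because the locale \<^locale>\<open>Metric_space\<close> demands
  nonnegativity and symmetry of the distance on the whole type.\<close>

definition norm_dist :: "'a::real_vector set \<Rightarrow> ('a \<Rightarrow> real) \<Rightarrow> 'a \<Rightarrow> 'a \<Rightarrow> real" where
  "norm_dist V N x y = (if x \<in> V \<and> y \<in> V then N (x - y) else 0)"

definition norm_topology :: "'a::real_vector set \<Rightarrow> ('a \<Rightarrow> real) \<Rightarrow> 'a topology" where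
  "norm_topology V N = Metric_space.mtopology V (norm_dist V N)"

definition banach_space_on :: "'a::real_vector set \<Rightarrow> ('a \<Rightarrow> real) \<Rightarrow> bool" where
  "banach_space_on V N \<longleftrightarrow>
     subspace V \<and> norm_on V N \<and> Metric_space.mcomplete V (norm_dist V N)"


section \<open>Rosenthal Banach spaces\<close>

definition l1_space :: "(nat \<Rightarrow> real) set" where
  "l1_space = {a. summable (\<lambda>n. \<bar>a n\<bar>)}"

definition l1_norm :: "(nat \<Rightarrow> real) \<Rightarrow> real" where
  "l1_norm a = (\<Sum>n. \<bar>a n\<bar>)"

text \<open>An isomorphic copy of \<open>l\<^sub>1\<close> in \<open>V\<close> is the image of a linear map
  \<open>J\<close> from \<open>l\<^sub>1\<close> to \<open>V\<close> that is bounded and bounded below.\<close>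

definition contains_l1 :: "'a::real_vector set \<Rightarrow> ('a \<Rightarrow> real) \<Rightarrow> bool" where
  "contains_l1 V N \<longleftrightarrow>
     (\<exists>J c C.
        J \<in> l1_space \<rightarrow> V \<and>
        (\<forall>a\<in>l1_space. \<forall>b\<in>l1_space. J (\<lambda>n. a n + b n) = J a + J b) \<and>
        (\<forall>r. \<forall>a\<in>l1_space. J (\<lambda>n. r * a n) = r *\<^sub>R J a) \<and>
        0 < c \<and>
        (\<forall>a\<in>l1_space. c * l1_norm a \<le> N (J a) \<and> N (J a) \<le> C * l1_norm a))"

definition rosenthal_space :: "'a::real_vector set \<Rightarrow> ('a \<Rightarrow> real) \<Rightarrow> bool" where
  "rosenthal_space V N \<longleftrightarrow> banach_space_on V N \<and> \<not> contains_l1 V N"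


section \<open>The isometry group with the strong operator topology\<close>

text \<open>As in \<^const>\<open>BijGroup\<close>, self-maps of a set are represented by functions that are
  \<^const>\<open>undefined\<close> off that set, and the product is composition.\<close>

definition isometries :: "'a::real_vector set \<Rightarrow> ('a \<Rightarrow> real) \<Rightarrow> ('a \<Rightarrow> 'a) set" where
  "isometries V N =
     {T \<in> Bij V.
        (\<forall>x\<in>V. \<forall>y\<in>V. T (x + y) = T x + T y) \<and>
        (\<forall>r. \<forall>x\<in>V. T (r *\<^sub>R x) = r *\<^sub>R T x) \<and>
        (\<forall>x\<in>V. N (T x) = N x)}"

definition Iso_group :: "'a::real_vector set \<Rightarrow> ('a \<Rightarrow> real) \<Rightarrow> ('a \<Rightarrow> 'a) monoid" where
  "Iso_group V N = (BijGroup V)\<lparr>carrier := isometries V N\<rparr>"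

text \<open>The topology of pointwise norm convergence on \<open>V\<close>, as a subspace of the product topology.
  The library's \<open>strong_operator_topology\<close> concerns operators between whole normed types.\<close>

definition Iso_strong_topology ::
    "'a::real_vector set \<Rightarrow> ('a \<Rightarrow> real) \<Rightarrow> ('a \<Rightarrow> 'a) topology" where
  "Iso_strong_topology V N =
     subtopology (product_topology (\<lambda>_. norm_topology V N) V) (isometries V N)"


section \<open>The group of increasing homeomorphisms of the unit interval\<close>

definition H_plus :: "(real \<Rightarrow> real) set" where
  "H_plus = {g \<in> Bij {0..1}.
     homeomorphic_map (top_of_set {0..1}) (top_of_set {0..1}) g \<and> strict_mono_on {0..1} g}"

definition H_plus_group :: "(real \<Rightarrow> real) monoid" where
  "H_plus_group = (BijGroup {0..1})\<lparr>carrier := H_plus\<rparr>"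

text \<open>The compact-open topology, given by its standard subbasis.\<close>

definition H_plus_topology :: "(real \<Rightarrow> real) topology" where
  "H_plus_topology = topology_generated_by
     {{g \<in> H_plus. g ` K \<subseteq> U} | K U.
        compactin (top_of_set {0..1}) K \<and> openin (top_of_set {0..1}) U}"


section \<open>Embeddings of topological groups\<close>

definition topological_group_embedding ::
    "('a, 'c) monoid_scheme \<Rightarrow> 'a topology \<Rightarrow> ('b, 'd) monoid_scheme \<Rightarrow> 'b topology
      \<Rightarrow> ('a \<Rightarrow> 'b) \<Rightarrow> bool" where
  "topological_group_embedding G S H T h \<longleftrightarrow> h \<in> hom G H \<and> embedding_map S T h"

end

theory Submission
  imports Defs
begin

text \<open>
  The representing space is the James function space: the closure of the
  continuous functions of bounded variation on the unit interval vanishing at 0 with respect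
  to the quadratic variation norm, whose square is the supremum of \<open>\<Sum> (\<Delta>f)\<^sup>2\<close> over all
  partitions. An increasing homeomorphism permutes the partitions, so \<open>f \<mapsto> f \<circ> g\<^sup>-\<^sup>1\<close> is an
  isometric action of the group.

  \<^emph>\<open>The topologies agree.\<close> If \<open>u\<close> has bounded variation, \<open>u \<circ> g\<^sup>-\<^sup>1 - u \<circ> h\<^sup>-\<^sup>1\<close> has bounded
  variation as well, and its quadratic variation norm is small as soon as it is uniformly small
  (\<open>qvar_le_sup_variation\<close>); by density the action is strongly continuous
  (\<open>james_action_continuous_at\<close>). Conversely \<open>g\<close>, taken as a vector of the space, is moved by
  \<open>h\<close> to a function whose distance from the image under \<open>g\<close> bounds the uniform distance of
  \<open>g\<close> and \<open>h\<close> (\<open>uniform_dist_le_orbit_dist\<close>).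

  \<^emph>\<open>There is no copy of \<open>l\<^sub>1\<close>.\<close> Let \<open>f\<^sub>n\<close> be the images of the unit vectors under an embedding
  of \<open>l\<^sub>1\<close>. Bounded quadratic variation makes the curves \<open>t \<mapsto> (f\<^sub>0 t, \<dots>, f\<^sub>m\<^sub>-\<^sub>1 t)\<close>
  coverable by a number of boxes that grows only linearly in \<open>m\<close>, so for suitable signs the
  average of \<open>\<plusminus>f\<^sub>n\<close> is uniformly as small as desired
  (\<open>signed_average_uniformly_small\<close>). A uniformly very small function is almost
  orthogonal to a given vector, in the sense that the square of the norm grows by a bounded amount
  only when it is added
  (\<open>james_norm_almost_pythagoras\<close>). Adding \<open>n\<close> such averages over disjoint blocks, chosen
  successively, gives a vector of norm \<open>O(\<surd>n)\<close> that is the image of a vector of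
  \<open>l\<^sub>1\<close> norm \<open>n\<close>, which is impossible for large \<open>n\<close> (\<open>james_no_l1\<close>).
\<close>

section \<open>Linear and quadratic variation\<close>

definition increment :: "(real \<Rightarrow> real) \<Rightarrow> (nat \<Rightarrow> real) \<Rightarrow> nat \<Rightarrow> real" where
  "increment f t i = f (t (Suc i)) - f (t i)"

definition variation_le :: "(real \<Rightarrow> real) \<Rightarrow> real \<Rightarrow> bool" where
  "variation_le f L \<longleftrightarrow> (\<forall>t n. mono t \<longrightarrow> (\<Sum>i<n. \<bar>increment f t i\<bar>) \<le> L)"

definition quadratic_variation :: "(real \<Rightarrow> real) \<Rightarrow> (nat \<Rightarrow> real) \<Rightarrow> nat \<Rightarrow> real" where
  "quadratic_variation f t n = L2_set (increment f t) {..<n}"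

definition qvar_le :: "(real \<Rightarrow> real) \<Rightarrow> real \<Rightarrow> bool" where
  "qvar_le f B \<longleftrightarrow> (\<forall>t n. mono t \<longrightarrow> quadratic_variation f t n \<le> B)"

lemma qvar_leD: "qvar_le f B \<Longrightarrow> mono t \<Longrightarrow> quadratic_variation f t n \<le> B"
  by (simp add: qvar_le_def)

lemma variation_leD: "variation_le f L \<Longrightarrow> mono t \<Longrightarrow> (\<Sum>i<n. \<bar>increment f t i\<bar>) \<le> L"
  by (simp add: variation_le_def)

lemma qvar_le_nonneg:
  assumes "qvar_le f B" shows "0 \<le> B"
  using qvar_leD[OF assms, of "\<lambda>_. 0" 0] by (simp add: quadratic_variation_def mono_def)

lemma variation_le_nonneg:
  assumes "variation_le f L" shows "0 \<le> L"
  using variation_leD[OF assms, of "\<lambda>_. 0" 0] by (simp add: mono_def)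

lemma qvar_le_mono: "qvar_le f B \<Longrightarrow> B \<le> B' \<Longrightarrow> qvar_le f B'"
  unfolding qvar_le_def by (meson order_trans)

lemma quadratic_variation_add:
  "quadratic_variation (\<lambda>x. f x + g x) t n \<le> quadratic_variation f t n + quadratic_variation g t n"
proof -
  have "increment (\<lambda>x. f x + g x) t = (\<lambda>i. increment f t i + increment g t i)"
    by (auto simp: increment_def)
  then show ?thesis
    unfolding quadratic_variation_def by (simp add: L2_set_triangle_ineq)
qed

lemma quadratic_variation_cmult:
  "quadratic_variation (\<lambda>x. r * f x) t n = \<bar>r\<bar> * quadratic_variation f t n"
proof -
  have "(\<Sum>i<n. (increment (\<lambda>x. r * f x) t i)\<^sup>2) = r\<^sup>2 * (\<Sum>i<n. (increment f t i)\<^sup>2)"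
    by (auto simp: increment_def sum_distrib_left power_mult_distrib simp flip: right_diff_distrib)
  then show ?thesis
    by (simp add: quadratic_variation_def L2_set_def real_sqrt_mult)
qed

lemma qvar_le_add:
  assumes "qvar_le f B" "qvar_le g D" shows "qvar_le (\<lambda>x. f x + g x) (B + D)"
  unfolding qvar_le_def
  using quadratic_variation_add qvar_leD[OF assms(1)] qvar_leD[OF assms(2)]
  by (meson add_mono order_trans)

lemma qvar_le_cmult:
  assumes "qvar_le f B" shows "qvar_le (\<lambda>x. r * f x) (\<bar>r\<bar> * B)"
  using assms by (auto simp: qvar_le_def quadratic_variation_cmult intro: mult_left_mono)

lemma qvar_le_diff:
  assumes "qvar_le f B" "qvar_le g D" shows "qvar_le (\<lambda>x. f x - g x) (B + D)"
  using qvar_le_add[OF assms(1) qvar_le_cmult[OF assms(2), of "-1"]] by simp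

lemma variation_le_add:
  assumes "variation_le f K" "variation_le g L" shows "variation_le (\<lambda>x. f x + g x) (K + L)"
  unfolding variation_le_def
proof (intro allI impI)
  fix t :: "nat \<Rightarrow> real" and n
  assume t: "mono t"
  have "(\<Sum>i<n. \<bar>increment (\<lambda>x. f x + g x) t i\<bar>)
      \<le> (\<Sum>i<n. \<bar>increment f t i\<bar> + \<bar>increment g t i\<bar>)"
    by (intro sum_mono) (auto simp: increment_def)
  also have "\<dots> \<le> K + L"
    using variation_leD[OF assms(1) t, of n] variation_leD[OF assms(2) t, of n]
    by (simp add: sum.distrib)
  finally show "(\<Sum>i<n. \<bar>increment (\<lambda>x. f x + g x) t i\<bar>) \<le> K + L" .
qed

lemma variation_le_cmult:
  assumes "variation_le f L" shows "variation_le (\<lambda>x. r * f x) (\<bar>r\<bar> * L)"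
proof -
  have "\<bar>increment (\<lambda>x. r * f x) t i\<bar> = \<bar>r\<bar> * \<bar>increment f t i\<bar>" for t i
    by (simp add: increment_def abs_mult flip: right_diff_distrib)
  then show ?thesis
    using assms by (auto simp: variation_le_def mult_left_mono simp flip: sum_distrib_left)
qed

lemma variation_le_diff:
  assumes "variation_le f K" "variation_le g L" shows "variation_le (\<lambda>x. f x - g x) (K + L)"
  using variation_le_add[OF assms(1) variation_le_cmult[OF assms(2), of "-1"]] by simp

lemma qvar_le_variation:
  assumes "variation_le u L" shows "qvar_le u L"
  unfolding qvar_le_def quadratic_variation_def
  by (intro allI impI order_trans[OF L2_set_le_sum_abs] variation_leD[OF assms])

text \<open>A square \<open>\<Delta>\<^sup>2\<close> is at most \<open>2 \<kappa> \<bar>\<Delta>\<bar>\<close> when the function is bounded by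
  \<open>\<kappa>\<close>. So on functions of bounded variation, uniform smallness forces smallness in
  quadratic variation; this is what makes the group act continuously.\<close>

lemma qvar_le_sup_variation:
  assumes "variation_le w L" "\<And>x. \<bar>w x\<bar> \<le> \<kappa>"
  shows "qvar_le w (sqrt (2 * \<kappa> * L))"
  unfolding qvar_le_def quadratic_variation_def L2_set_def
proof (intro allI impI real_sqrt_le_mono)
  fix t :: "nat \<Rightarrow> real" and n
  assume t: "mono t"
  have \<kappa>: "0 \<le> \<kappa>" using assms(2)[of 0] by linarith
  have "(\<Sum>i<n. (increment w t i)\<^sup>2) \<le> (\<Sum>i<n. 2 * \<kappa> * \<bar>increment w t i\<bar>)"
  proof (rule sum_mono)
    fix i
    have "\<bar>increment w t i\<bar> \<le> 2 * \<kappa>"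
      using assms(2)[of "t i"] assms(2)[of "t (Suc i)"] by (simp add: increment_def)
    from mult_right_mono[OF this, of "\<bar>increment w t i\<bar>"]
    show "(increment w t i)\<^sup>2 \<le> 2 * \<kappa> * \<bar>increment w t i\<bar>"
      by (simp add: power2_eq_square)
  qed
  also have "\<dots> \<le> 2 * \<kappa> * L"
    using variation_leD[OF assms(1) t, of n] \<kappa> by (simp add: mult_left_mono flip: sum_distrib_left)
  finally show "(\<Sum>i<n. (increment w t i)\<^sup>2) \<le> 2 * \<kappa> * L" .
qed

text \<open>An increasing change of parameter maps partitions to partitions; \<open>mono\<close> rather than
  \<open>strict_mono\<close> in the definitions lets it collapse points.\<close>

lemma qvar_le_reparametrize:
  assumes "qvar_le f B" "mono \<phi>" shows "qvar_le (\<lambda>x. f (\<phi> x)) B"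
  unfolding qvar_le_def
proof (intro allI impI)
  fix t :: "nat \<Rightarrow> real" and n
  assume "mono t"
  then have "mono (\<lambda>i. \<phi> (t i))"
    using assms(2) by (simp add: mono_def)
  from qvar_leD[OF assms(1) this] show "quadratic_variation (\<lambda>x. f (\<phi> x)) t n \<le> B"
    by (simp add: quadratic_variation_def increment_def[abs_def])
qed

lemma variation_le_reparametrize:
  assumes "variation_le f L" "mono \<phi>" shows "variation_le (\<lambda>x. f (\<phi> x)) L"
  unfolding variation_le_def
proof (intro allI impI)
  fix t :: "nat \<Rightarrow> real" and n
  assume "mono t"
  then have "mono (\<lambda>i. \<phi> (t i))"
    using assms(2) by (simp add: mono_def)
  from variation_leD[OF assms(1) this] show "(\<Sum>i<n. \<bar>increment (\<lambda>x. f (\<phi> x)) t i\<bar>) \<le> L"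
    by (simp add: increment_def)
qed

lemma qvar_le_imp_abs_diff_le:
  assumes "qvar_le f B" shows "\<bar>f x - f y\<bar> \<le> B"
proof -
  have *: "\<bar>f x - f y\<bar> \<le> B" if "x \<le> y" for x y
  proof -
    have "mono (\<lambda>i::nat. if i = 0 then x else y)"
      using that by (auto simp: mono_def)
    from qvar_leD[OF assms this, of 1] show ?thesis
      by (simp add: quadratic_variation_def increment_def L2_set_def abs_minus_commute)
  qed
  show ?thesis
    using *[of x y] *[of y x] by (cases "x \<le> y") (auto simp: abs_minus_commute)
qed

text \<open>For a fixed partition the sum is continuous under pointwise convergence, so the supremum over
  partitions is lower semicontinuous.\<close>

lemma qvar_le_limit:
  assumes "\<And>x. (\<lambda>m. f m x) \<longlonglongrightarrow> g x" "\<forall>\<^sub>F m in sequentially. qvar_le (f m) B"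
  shows "qvar_le g B"
  unfolding qvar_le_def
proof (intro allI impI)
  fix t :: "nat \<Rightarrow> real" and n
  assume t: "mono t"
  have "(\<lambda>m. quadratic_variation (f m) t n) \<longlonglongrightarrow> quadratic_variation g t n"
    unfolding quadratic_variation_def increment_def L2_set_def
    by (intro tendsto_intros assms)
  then show "quadratic_variation g t n \<le> B"
    by (rule tendsto_upperbound) (use assms(2) qvar_leD[OF _ t] in \<open>auto elim: eventually_mono\<close>)
qed


section \<open>Signed averages that are uniformly small\<close>

text \<open>Signs are chosen one at a time so that the fourth moment of the signed sums stays as small
  as for random signs. Averaging over the sign of the last term \<open>y\<close>, with \<open>y\<^sup>2 \<le> C\<^sup>2\<close>, gives
  \<open>((S + y)\<^sup>2 + b)\<^sup>2 + ((S - y)\<^sup>2 + b)\<^sup>2 \<le> 2 (S\<^sup>2 + b + 3 C\<^sup>2)\<^sup>2\<close>, so the potential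
  \<open>(S\<^sup>2 + b)\<^sup>2\<close> with \<open>b\<close> decreasing by \<open>3 C\<^sup>2\<close> at each step need not grow.\<close>

lemma signs_with_small_fourth_moment:
  fixes x :: "nat \<Rightarrow> 'p \<Rightarrow> real"
  assumes C: "\<And>n p. p \<in> P \<Longrightarrow> \<bar>x n p\<bar> \<le> C" and "0 \<le> b"
  shows "\<exists>s. (\<forall>n. \<bar>s n\<bar> = 1) \<and>
    (\<Sum>p\<in>P. ((\<Sum>n<m. s n * x n p)\<^sup>2 + b)\<^sup>2) \<le> real (card P) * (3 * C\<^sup>2 * real m + b)\<^sup>2"
  using \<open>0 \<le> b\<close>
proof (induction m arbitrary: b)
  case 0
  show ?case by (rule exI[of _ "\<lambda>_. 1"]) simp
next
  case (Suc m)
  have "0 \<le> b + 3 * C\<^sup>2" using Suc.prems by simp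
  from Suc.IH[OF this] obtain s where s: "\<And>n. \<bar>s n\<bar> = 1"
    and le: "(\<Sum>p\<in>P. ((\<Sum>n<m. s n * x n p)\<^sup>2 + (b + 3 * C\<^sup>2))\<^sup>2)
      \<le> real (card P) * (3 * C\<^sup>2 * real m + (b + 3 * C\<^sup>2))\<^sup>2"
    by blast
  define S where "S p = (\<Sum>n<m. s n * x n p)" for p
  define \<Phi> where "\<Phi> r = (\<Sum>p\<in>P. ((S p + r * x m p)\<^sup>2 + b)\<^sup>2)" for r
  have "\<Phi> 1 + \<Phi> (-1) \<le> (\<Sum>p\<in>P. 2 * ((S p)\<^sup>2 + (b + 3 * C\<^sup>2))\<^sup>2)"
    unfolding \<Phi>_def sum.distrib[symmetric]
  proof (rule sum_mono)
    fix p assume p: "p \<in> P"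
    define y where "y = (x m p)\<^sup>2"
    have y: "0 \<le> y" "y \<le> C\<^sup>2"
      using C[OF p, of m] by (auto simp: y_def abs_le_square_iff[symmetric])
    have eq: "((S p + 1 * x m p)\<^sup>2 + b)\<^sup>2 + ((S p + (-1) * x m p)\<^sup>2 + b)\<^sup>2
        = 2 * (((S p)\<^sup>2 + b)\<^sup>2 + y * (6 * (S p)\<^sup>2 + 2 * b) + y * y)"
      unfolding y_def by algebra
    have arith: "2 * (X + Y + Z) \<le> 2 * W"
      if "Y \<le> Y'" "Z \<le> Z'" "W = X + Y' + 9 * Z'" "0 \<le> Z'"
      for X Y Z W Y' Z' :: real
    proof -
      have "X + Y + Z \<le> X + Y' + Z'"
        using that(1,2) by simp
      also have "\<dots> \<le> W"
        using that(3,4) by simp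
      finally show ?thesis by simp
    qed
    have "y * (6 * (S p)\<^sup>2 + 2 * b) \<le> C\<^sup>2 * (6 * (S p)\<^sup>2 + 6 * b)"
      using y Suc.prems by (intro mult_mono) auto
    moreover have "y * y \<le> C\<^sup>2 * C\<^sup>2"
      using y by (intro mult_mono) auto
    moreover have "((S p)\<^sup>2 + (b + 3 * C\<^sup>2))\<^sup>2
        = ((S p)\<^sup>2 + b)\<^sup>2 + C\<^sup>2 * (6 * (S p)\<^sup>2 + 6 * b) + 9 * (C\<^sup>2 * C\<^sup>2)"
      by algebra
    moreover have "0 \<le> C\<^sup>2 * C\<^sup>2" by simp
    ultimately show "((S p + 1 * x m p)\<^sup>2 + b)\<^sup>2 + ((S p + (-1) * x m p)\<^sup>2 + b)\<^sup>2
        \<le> 2 * ((S p)\<^sup>2 + (b + 3 * C\<^sup>2))\<^sup>2"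
      unfolding eq by (rule arith)
  qed
  also have "\<dots> \<le> 2 * (real (card P) * (3 * C\<^sup>2 * real m + (b + 3 * C\<^sup>2))\<^sup>2)"
    using le by (simp add: S_def flip: sum_distrib_left)
  also have "3 * C\<^sup>2 * real m + (b + 3 * C\<^sup>2) = 3 * C\<^sup>2 * real (Suc m) + b"
    by (simp add: algebra_simps)
  finally have "\<Phi> 1 \<le> real (card P) * (3 * C\<^sup>2 * real (Suc m) + b)\<^sup>2
      \<or> \<Phi> (-1) \<le> real (card P) * (3 * C\<^sup>2 * real (Suc m) + b)\<^sup>2"
    by linarith
  then obtain r where r: "\<bar>r\<bar> = 1"
    and \<Phi>: "\<Phi> r \<le> real (card P) * (3 * C\<^sup>2 * real (Suc m) + b)\<^sup>2"
    by force
  have "(\<Sum>n<Suc m. (s(m := r)) n * x n p) = S p + r * x m p" for p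
    by (simp add: S_def)
  then show ?case
    using s r \<Phi> by (intro exI[of _ "s(m := r)"]) (simp add: \<Phi>_def)
qed

text \<open>The curve \<open>t \<mapsto> (f\<^sub>0 t, \<dots>, f\<^sub>m\<^sub>-\<^sub>1 t)\<close> has small entropy in the maximum norm:
  every move by more than \<open>\<epsilon>\<close> uses up \<open>\<epsilon>\<^sup>2\<close> of the total quadratic variation
  \<open>m C\<^sup>2\<close> of the coordinates, so an \<open>\<epsilon>\<close>-separated set of parameters has at most
  \<open>1 + m C\<^sup>2 / \<epsilon>\<^sup>2\<close> elements. This count is polynomial in \<open>m\<close>, whereas \<open>l\<^sub>1\<close>
  behaviour in the uniform norm would need exponentially many points.\<close>

lemma separated_parameters_card_le:
  fixes f :: "nat \<Rightarrow> real \<Rightarrow> real"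
  assumes qv: "\<And>n. qvar_le (f n) C" and "0 < \<epsilon>" "finite P"
    and sep: "\<And>p q. p \<in> P \<Longrightarrow> q \<in> P \<Longrightarrow> p \<noteq> q \<Longrightarrow> \<exists>n<m. \<epsilon> < \<bar>f n p - f n q\<bar>"
  shows "real (card P) \<le> 1 + real m * C\<^sup>2 / \<epsilon>\<^sup>2"
proof (cases "P = {}")
  case True
  then show ?thesis by simp
next
  case False
  define l where "l = sorted_list_of_set P"
  define k where "k = card P - 1"
  have card: "card P = Suc k"
    using False \<open>finite P\<close> by (simp add: k_def card_gt_0_iff)
  have len: "length l = Suc k" and set: "set l = P" and dist: "distinct l" and sorted: "sorted l"
    using \<open>finite P\<close> card by (auto simp: l_def)
  \<comment> \<open>Partitions are infinite monotone sequences; this one stays at the last point of \<open>P\<close>.\<close>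
  define t where "t i = l ! (min i k)" for i
  have t: "mono t"
    unfolding t_def mono_def using sorted len by (auto intro!: sorted_nth_mono)
  have "\<epsilon>\<^sup>2 \<le> (\<Sum>n<m. (increment (f n) t i)\<^sup>2)" if "i < k" for i
  proof -
    have "t (Suc i) \<in> P" "t i \<in> P"
      using set len that by (auto simp: t_def)
    moreover have "t (Suc i) \<noteq> t i"
      using that dist len by (simp add: t_def nth_eq_iff_index_eq)
    ultimately obtain n where n: "n < m" "\<epsilon> < \<bar>increment (f n) t i\<bar>"
      using sep unfolding increment_def by blast
    have "\<epsilon>\<^sup>2 \<le> (increment (f n) t i)\<^sup>2"
      using n(2) \<open>0 < \<epsilon>\<close> by (simp add: abs_le_square_iff[symmetric])
    also have "\<dots> \<le> (\<Sum>n<m. (increment (f n) t i)\<^sup>2)"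
      using n(1) by (intro member_le_sum) auto
    finally show ?thesis .
  qed
  then have "(\<Sum>i<k. \<epsilon>\<^sup>2) \<le> (\<Sum>i<k. \<Sum>n<m. (increment (f n) t i)\<^sup>2)"
    by (intro sum_mono) auto
  also have "\<dots> = (\<Sum>n<m. \<Sum>i<k. (increment (f n) t i)\<^sup>2)"
    by (rule sum.swap)
  also have "\<dots> \<le> (\<Sum>n<m. C\<^sup>2)"
  proof (rule sum_mono)
    fix n
    have "sqrt (\<Sum>i<k. (increment (f n) t i)\<^sup>2) \<le> C"
      using qvar_leD[OF qv t, of n k] by (simp add: quadratic_variation_def L2_set_def)
    then show "(\<Sum>i<k. (increment (f n) t i)\<^sup>2) \<le> C\<^sup>2"
      by (rule sqrt_le_D)
  qed
  finally have "real k * \<epsilon>\<^sup>2 \<le> real m * C\<^sup>2"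
    by simp
  then show ?thesis
    using \<open>0 < \<epsilon>\<close> card by (simp add: field_simps)
qed

lemma parameter_net:
  fixes f :: "nat \<Rightarrow> real \<Rightarrow> real"
  assumes qv: "\<And>n. qvar_le (f n) C" and "0 < \<epsilon>"
  shows "\<exists>P. finite P \<and> real (card P) \<le> 1 + real m * C\<^sup>2 / \<epsilon>\<^sup>2 \<and>
    (\<forall>t. \<exists>p\<in>P. \<forall>n<m. \<bar>f n t - f n p\<bar> \<le> \<epsilon>)"
proof -
  define sep where "sep P \<longleftrightarrow> finite P \<and>
    (\<forall>p\<in>P. \<forall>q\<in>P. p \<noteq> q \<longrightarrow> (\<exists>n<m. \<epsilon> < \<bar>f n p - f n q\<bar>))" for P
  have bound: "real (card P) \<le> 1 + real m * C\<^sup>2 / \<epsilon>\<^sup>2" if "sep P" for P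
    using that unfolding sep_def
    by (intro separated_parameters_card_le[of f] qv \<open>0 < \<epsilon>\<close>) auto
  then have "\<forall>P. sep P \<longrightarrow> card P < Suc (nat \<lfloor>1 + real m * C\<^sup>2 / \<epsilon>\<^sup>2\<rfloor>)"
    by (auto simp only: less_Suc_eq_le intro!: le_nat_floor)
  moreover have "sep {}" by (simp add: sep_def)
  ultimately obtain P where P: "sep P" and max: "\<And>Q. sep Q \<Longrightarrow> card Q \<le> card P"
    using ex_has_greatest_nat[of sep "{}" card] by blast
  have "\<exists>p\<in>P. \<forall>n<m. \<bar>f n t - f n p\<bar> \<le> \<epsilon>" for t
  proof (rule ccontr)
    assume far: "\<not> ?thesis"
    then have "t \<notin> P" using \<open>0 < \<epsilon>\<close> by force
    have "sep (insert t P)"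
      using P far unfolding sep_def by (auto simp: not_le) (metis abs_minus_commute)
    from max[OF this] show False
      using P \<open>t \<notin> P\<close> by (simp add: sep_def)
  qed
  then show ?thesis
    using P bound[OF P] unfolding sep_def by blast
qed

text \<open>For the \<open>O(m)\<close> points of a net the fourth powers of the signed sums add up to \<open>O(m\<^sup>3)\<close>, so
  each sum is \<open>O(m\<^sup>3\<^sup>/\<^sup>4)\<close>, which is negligible against \<open>m\<close>. The second moment would not do: its
  total over the net is \<open>O(m\<^sup>2)\<close>, of the same order as \<open>m\<^sup>2\<close>.\<close>

lemma signed_average_uniformly_small:
  fixes f :: "nat \<Rightarrow> real \<Rightarrow> real"
  assumes qv: "\<And>n. qvar_le (f n) C" and C: "\<And>n t. \<bar>f n t\<bar> \<le> C" and "0 < \<epsilon>"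
  shows "\<exists>m s. 0 < m \<and> (\<forall>n. \<bar>s n\<bar> = 1) \<and> (\<forall>t. \<bar>(\<Sum>n<m. s n * f n t) / real m\<bar> \<le> \<epsilon>)"
proof -
  define \<delta> where "\<delta> = \<epsilon> / 2"
  have "0 < \<delta>" using \<open>0 < \<epsilon>\<close> by (simp add: \<delta>_def)
  define K where "K = (1 + C\<^sup>2 / \<delta>\<^sup>2) * (3 * C\<^sup>2)\<^sup>2"
  obtain m :: nat where m: "K / \<delta> ^ 4 + 1 < real m"
    using reals_Archimedean2 by blast
  have "0 \<le> K" by (simp add: K_def)
  then have "0 \<le> K / \<delta> ^ 4" using \<open>0 < \<delta>\<close> by simp
  with m have m0: "1 \<le> real m" "0 < m" by auto
  have Km: "K \<le> real m * \<delta> ^ 4"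
    using mult_right_mono[of "K / \<delta> ^ 4" "real m" "\<delta> ^ 4"] m \<open>0 < \<delta>\<close> by simp
  obtain P where P: "finite P" "real (card P) \<le> 1 + real m * C\<^sup>2 / \<delta>\<^sup>2"
    and net: "\<And>t. \<exists>p\<in>P. \<forall>n<m. \<bar>f n t - f n p\<bar> \<le> \<delta>"
    using parameter_net[of f C, OF qv \<open>0 < \<delta>\<close>] by blast
  obtain s where s: "\<And>n. \<bar>s n\<bar> = 1"
    and fourth: "(\<Sum>p\<in>P. ((\<Sum>n<m. s n * f n p)\<^sup>2 + 0)\<^sup>2) \<le> real (card P) * (3 * C\<^sup>2 * real m + 0)\<^sup>2"
    using signs_with_small_fourth_moment[of P f C 0 m] C by auto
  have at_net: "\<bar>\<Sum>n<m. s n * f n p\<bar> \<le> real m * \<delta>" if "p \<in> P" for p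
  proof -
    have "(\<Sum>n<m. s n * f n p) ^ 4 \<le> (\<Sum>p\<in>P. (\<Sum>n<m. s n * f n p) ^ 4)"
      using that P(1) by (intro member_le_sum) auto
    also have "\<dots> \<le> real (card P) * (3 * C\<^sup>2 * real m)\<^sup>2"
      using fourth by (simp flip: power_mult)
    also have "\<dots> \<le> (real m * (1 + C\<^sup>2 / \<delta>\<^sup>2)) * (3 * C\<^sup>2 * real m)\<^sup>2"
    proof (rule mult_right_mono)
      show "real (card P) \<le> real m * (1 + C\<^sup>2 / \<delta>\<^sup>2)"
        using P(2) m0(1) by (simp add: distrib_left)
    qed simp
    also have "\<dots> = real m ^ 3 * K"
      by (simp add: K_def power2_eq_square power3_eq_cube)
    also have "\<dots> \<le> real m ^ 3 * (real m * \<delta> ^ 4)"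
      by (intro mult_left_mono Km) simp
    also have "\<dots> = (real m * \<delta>) ^ 4"
      by (simp add: power_mult_distrib power3_eq_cube power4_eq_xxxx)
    finally have "\<bar>\<Sum>n<m. s n * f n p\<bar> ^ 4 \<le> (real m * \<delta>) ^ 4"
      by (simp add: power_even_abs)
    then show ?thesis
      by (subst (asm) power_mono_iff) (use \<open>0 < \<delta>\<close> in auto)
  qed
  have "\<bar>(\<Sum>n<m. s n * f n t) / real m\<bar> \<le> \<epsilon>" for t
  proof -
    obtain p where p: "p \<in> P" "\<And>n. n < m \<Longrightarrow> \<bar>f n t - f n p\<bar> \<le> \<delta>"
      using net[of t] by blast
    have "\<bar>\<Sum>n<m. s n * (f n t - f n p)\<bar> \<le> (\<Sum>n<m. \<bar>s n * (f n t - f n p)\<bar>)"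
      by (rule sum_abs)
    also have "\<dots> \<le> (\<Sum>n<m. \<delta>)"
      using p(2) s by (intro sum_mono) (auto simp: abs_mult)
    finally have "\<bar>\<Sum>n<m. s n * (f n t - f n p)\<bar> \<le> real m * \<delta>" by simp
    moreover have "(\<Sum>n<m. s n * f n t) = (\<Sum>n<m. s n * f n p) + (\<Sum>n<m. s n * (f n t - f n p))"
      by (simp add: algebra_simps flip: sum.distrib)
    moreover have "real m * \<delta> + real m * \<delta> = real m * \<epsilon>"
      by (simp add: \<delta>_def)
    ultimately have "\<bar>\<Sum>n<m. s n * f n t\<bar> \<le> real m * \<epsilon>"
      using at_net[OF p(1)] by linarith
    then show ?thesis
      using m0 by (simp add: field_simps)
  qed
  then show ?thesis
    using m0 s by blast
qed


section \<open>The James function space\<close>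

text \<open>Functions on the unit interval vanishing at 0 are represented by their extensions to the
  line that are constant to the left of 0 and to the right of 1. Both the continuity of the action
  and the absence of \<open>l\<^sub>1\<close> rest on the approximability by functions of bounded variation.\<close>

definition james_space :: "(real \<Rightarrow>\<^sub>C real) set" where
  "james_space = {f :: real \<Rightarrow>\<^sub>C real. (\<forall>t\<le>0. f t = 0) \<and> (\<forall>t\<ge>1. f t = f 1) \<and>
     (\<forall>\<eta>>0. \<exists>(u :: real \<Rightarrow>\<^sub>C real) L. variation_le u L \<and> qvar_le (\<lambda>x. f x - u x) \<eta>)}"

definition james_norm :: "(real \<Rightarrow>\<^sub>C real) \<Rightarrow> real" where
  "james_norm f = Sup {quadratic_variation f t n | t n. mono t}"

lemma james_space_approx:
  assumes "f \<in> james_space" "0 < \<eta>"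
  obtains u :: "real \<Rightarrow>\<^sub>C real" and L
  where "variation_le u L" "qvar_le (\<lambda>x. f x - u x) \<eta>"
  using assms by (auto simp: james_space_def)

lemma james_space_left: "f \<in> james_space \<Longrightarrow> t \<le> 0 \<Longrightarrow> f t = 0"
  by (simp add: james_space_def)

lemma james_space_right: "f \<in> james_space \<Longrightarrow> 1 \<le> t \<Longrightarrow> f t = f 1"
  unfolding james_space_def by blast

lemma james_spaceI:
  fixes f :: "real \<Rightarrow>\<^sub>C real"
  assumes "\<And>t. t \<le> 0 \<Longrightarrow> f t = 0" "\<And>t. 1 \<le> t \<Longrightarrow> f t = f 1"
    and "\<And>\<eta>. 0 < \<eta> \<Longrightarrow>
      \<exists>(u :: real \<Rightarrow>\<^sub>C real) L. variation_le u L \<and> qvar_le (\<lambda>x. f x - u x) \<eta>"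
  shows "f \<in> james_space"
  unfolding james_space_def using assms by blast

lemma james_space_qvar_bounded:
  assumes "f \<in> james_space" shows "\<exists>B. qvar_le f B"
proof -
  obtain u :: "real \<Rightarrow>\<^sub>C real" and L
    where u: "variation_le u L" "qvar_le (\<lambda>x. f x - u x) 1"
    using james_space_approx[OF assms, of 1] by auto
  from qvar_le_add[OF u(2) qvar_le_variation[OF u(1)]] show ?thesis
    by auto
qed

lemma james_norm_le:
  fixes f :: "real \<Rightarrow>\<^sub>C real"
  assumes "qvar_le f B" shows "james_norm f \<le> B"
  unfolding james_norm_def
proof (rule cSup_least)
  have "mono (\<lambda>_::nat. 0::real)" by (simp add: mono_def)
  then show "{quadratic_variation f t n | t n. mono t} \<noteq> {}" by blast
qed (use assms in \<open>auto simp: qvar_le_def\<close>)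

lemma qvar_le_james_norm:
  assumes "f \<in> james_space" shows "qvar_le f (james_norm f)"
proof -
  obtain B where B: "qvar_le f B" using james_space_qvar_bounded[OF assms] by blast
  have "bdd_above {quadratic_variation f t n | t n. mono t}"
    using B by (auto simp: bdd_above_def qvar_le_def)
  then show ?thesis
    unfolding qvar_le_def james_norm_def by (blast intro: cSup_upper)
qed

lemma james_norm_le_iff: "f \<in> james_space \<Longrightarrow> james_norm f \<le> B \<longleftrightarrow> qvar_le f B"
  using james_norm_le qvar_le_james_norm qvar_le_mono by blast

lemma abs_le_james_norm:
  assumes "f \<in> james_space" shows "\<bar>f t\<bar> \<le> james_norm f"
  using qvar_le_imp_abs_diff_le[OF qvar_le_james_norm[OF assms], of t 0]
    james_space_left[OF assms, of 0] by simp

lemma norm_le_james_norm: "f \<in> james_space \<Longrightarrow> norm f \<le> james_norm f"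
  by (rule norm_bound) (simp add: abs_le_james_norm)

lemma james_spaceI_variation:
  fixes f :: "real \<Rightarrow>\<^sub>C real"
  assumes "\<And>t. t \<le> 0 \<Longrightarrow> f t = 0" "\<And>t. 1 \<le> t \<Longrightarrow> f t = f 1" "variation_le f L"
  shows "f \<in> james_space"
proof -
  have "qvar_le (\<lambda>x. f x - f x) \<eta>" if "0 < \<eta>" for \<eta>
    using that by (simp add: qvar_le_def quadratic_variation_def increment_def L2_set_def)
  then show ?thesis
    using assms by (intro james_spaceI) blast+
qed

lemma subspace_james_space: "subspace james_space"
proof (rule subspaceI)
  show "0 \<in> james_space"
    by (rule james_spaceI_variation[of _ 0]) (auto simp: variation_le_def increment_def)
next
  fix f g :: "real \<Rightarrow>\<^sub>C real"
  assume fg: "f \<in> james_space" "g \<in> james_space"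
  show "f + g \<in> james_space"
  proof (rule james_spaceI)
    fix t :: real
    show "(f + g) t = 0" if "t \<le> 0"
      using fg that by (simp add: james_space_left)
    show "(f + g) t = (f + g) 1" if "1 \<le> t"
      using james_space_right[OF fg(1) that] james_space_right[OF fg(2) that] by simp
  next
    fix \<eta> :: real assume "0 < \<eta>"
    then have "0 < \<eta> / 2" by simp
    obtain u :: "real \<Rightarrow>\<^sub>C real" and K
      where u: "variation_le u K" "qvar_le (\<lambda>x. f x - u x) (\<eta> / 2)"
      using james_space_approx[OF fg(1) \<open>0 < \<eta> / 2\<close>] .
    obtain v :: "real \<Rightarrow>\<^sub>C real" and L
      where v: "variation_le v L" "qvar_le (\<lambda>x. g x - v x) (\<eta> / 2)"
      using james_space_approx[OF fg(2) \<open>0 < \<eta> / 2\<close>] .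
    have "variation_le (u + v) (K + L)"
      using variation_le_add[OF u(1) v(1)] by (simp add: plus_bcontfun.rep_eq)
    moreover have "qvar_le (\<lambda>x. (f + g) x - (u + v) x) \<eta>"
      using qvar_le_add[OF u(2) v(2)] by (simp add: algebra_simps)
    ultimately show "\<exists>(w :: real \<Rightarrow>\<^sub>C real) L.
        variation_le w L \<and> qvar_le (\<lambda>x. (f + g) x - w x) \<eta>"
      by blast
  qed
next
  fix r and f :: "real \<Rightarrow>\<^sub>C real"
  assume f: "f \<in> james_space"
  show "r *\<^sub>R f \<in> james_space"
  proof (rule james_spaceI)
    fix t :: real
    show "(r *\<^sub>R f) t = 0" if "t \<le> 0"
      using f that by (simp add: james_space_left)
    show "(r *\<^sub>R f) t = (r *\<^sub>R f) 1" if "1 \<le> t"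
      using james_space_right[OF f that] by simp
  next
    fix \<eta> :: real assume \<eta>: "0 < \<eta>"
    then have "0 < \<eta> / (\<bar>r\<bar> + 1)" by simp
    obtain u :: "real \<Rightarrow>\<^sub>C real" and L
      where u: "variation_le u L" "qvar_le (\<lambda>x. f x - u x) (\<eta> / (\<bar>r\<bar> + 1))"
      using james_space_approx[OF f \<open>0 < \<eta> / (\<bar>r\<bar> + 1)\<close>] .
    have "variation_le (r *\<^sub>R u) (\<bar>r\<bar> * L)"
      using variation_le_cmult[OF u(1)] by (simp add: scaleR_bcontfun.rep_eq)
    moreover have "qvar_le (\<lambda>x. (r *\<^sub>R f) x - (r *\<^sub>R u) x) \<eta>"
    proof (rule qvar_le_mono)
      show "qvar_le (\<lambda>x. (r *\<^sub>R f) x - (r *\<^sub>R u) x) (\<bar>r\<bar> * (\<eta> / (\<bar>r\<bar> + 1)))"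
        using qvar_le_cmult[OF u(2)] by (simp add: algebra_simps)
      show "\<bar>r\<bar> * (\<eta> / (\<bar>r\<bar> + 1)) \<le> \<eta>"
        using \<eta> by (simp add: field_simps)
    qed
    ultimately show "\<exists>(w :: real \<Rightarrow>\<^sub>C real) L.
        variation_le w L \<and> qvar_le (\<lambda>x. (r *\<^sub>R f) x - w x) \<eta>"
      by blast
  qed
qed

lemmas james_space_diff = subspace_diff[OF subspace_james_space]

lemma norm_on_james: "norm_on james_space james_norm"
  unfolding norm_on_def
proof (intro conjI ballI allI)
  fix f assume f: "f \<in> james_space"
  show "0 \<le> james_norm f"
    using qvar_le_nonneg[OF qvar_le_james_norm[OF f]] .
  show "james_norm f = 0 \<longleftrightarrow> f = 0"
  proof
    assume "james_norm f = 0"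
    then show "f = 0"
      using norm_le_james_norm[OF f] by simp
  next
    assume "f = 0"
    then have "qvar_le f 0"
      by (simp add: qvar_le_def quadratic_variation_def increment_def L2_set_def)
    then show "james_norm f = 0"
      using james_norm_le \<open>0 \<le> james_norm f\<close> by force
  qed
next
  fix f r assume f: "f \<in> james_space"
  have le: "james_norm (r *\<^sub>R f) \<le> \<bar>r\<bar> * james_norm f" if "f \<in> james_space" for f r
    using james_norm_le qvar_le_cmult[OF qvar_le_james_norm[OF that], of r]
    by (simp add: scaleR_bcontfun.rep_eq)
  show "james_norm (r *\<^sub>R f) = \<bar>r\<bar> * james_norm f"
  proof (cases "r = 0")
    case True
    have "0 \<le> james_norm (r *\<^sub>R f)"
      using qvar_le_nonneg[OF qvar_le_james_norm[OF subspace_mul[OF subspace_james_space f]]] .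
    then show ?thesis
      using le[OF f, of r] True by simp
  next
    case False
    have "james_norm f \<le> \<bar>inverse r\<bar> * james_norm (r *\<^sub>R f)"
      using le[OF subspace_mul[OF subspace_james_space f], of "inverse r" r] False by simp
    then show ?thesis
      using le[OF f, of r] False by (simp add: field_simps)
  qed
next
  fix f g assume "f \<in> james_space" "g \<in> james_space"
  from qvar_le_add[OF this[THEN qvar_le_james_norm]]
  show "james_norm (f + g) \<le> james_norm f + james_norm g"
    by (intro james_norm_le) (simp add: plus_bcontfun.rep_eq)
qed

lemma Metric_space_norm_dist:
  assumes "subspace V" "norm_on V N"
  shows "Metric_space V (norm_dist V N)"
proof
  fix x y
  show "0 \<le> norm_dist V N x y"
    using assms by (auto simp: norm_dist_def norm_on_def subspace_diff)
  show "norm_dist V N x y = norm_dist V N y x"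
  proof (cases "x \<in> V \<and> y \<in> V")
    case True
    then have "N ((-1) *\<^sub>R (x - y)) = \<bar>-1\<bar> * N (x - y)"
      using assms subspace_diff[OF assms(1), of x y] unfolding norm_on_def by blast
    then show ?thesis
      using True by (simp add: norm_dist_def)
  qed (auto simp: norm_dist_def)
next
  fix x y assume "x \<in> V" "y \<in> V"
  then show "norm_dist V N x y = 0 \<longleftrightarrow> x = y"
    using assms subspace_diff[OF assms(1), of x y] by (auto simp: norm_dist_def norm_on_def)
next
  fix x y z assume V: "x \<in> V" "y \<in> V" "z \<in> V"
  have "N (a + b) \<le> N a + N b" if "a \<in> V" "b \<in> V" for a b
    using assms(2) that by (simp add: norm_on_def)
  from this[of "x - y" "y - z"] have "N ((x - y) + (y - z)) \<le> N (x - y) + N (y - z)"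
    using subspace_diff[OF assms(1)] V by blast
  then show "norm_dist V N x z \<le> norm_dist V N x y + norm_dist V N y z"
    using V by (simp add: norm_dist_def)
qed

interpretation james: Metric_space james_space "norm_dist james_space james_norm"
  by (rule Metric_space_norm_dist[OF subspace_james_space norm_on_james])

lemma james_dist:
  "f \<in> james_space \<Longrightarrow> g \<in> james_space \<Longrightarrow>
    norm_dist james_space james_norm f g = james_norm (f - g)"
  by (simp add: norm_dist_def)

text \<open>A Cauchy sequence for the quadratic variation norm is uniformly Cauchy. Its uniform limit
  is also its limit for the quadratic variation norm by lower semicontinuity, and approximability
  by functions of bounded variation passes to such limits.\<close>

lemma mcomplete_james: "james.mcomplete"
  unfolding james.mcomplete_def
proof (intro allI impI)
  fix \<sigma> assume C: "james.MCauchy \<sigma>"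
  then have \<sigma>: "\<And>n. \<sigma> n \<in> james_space"
    by (auto simp: james.MCauchy_def)
  have Cauchy_norm: "\<exists>M. \<forall>m\<ge>M. \<forall>n\<ge>M. qvar_le (\<lambda>x. \<sigma> m x - \<sigma> n x) e" if "0 < e" for e
  proof -
    have "\<exists>M. \<forall>m n. M \<le> m \<longrightarrow> M \<le> n \<longrightarrow>
        norm_dist james_space james_norm (\<sigma> m) (\<sigma> n) < e"
      using C that unfolding james.MCauchy_def by auto
    then obtain M where M: "\<And>m n. M \<le> m \<Longrightarrow> M \<le> n \<Longrightarrow>
        norm_dist james_space james_norm (\<sigma> m) (\<sigma> n) < e"
      by blast
    have "qvar_le (\<lambda>x. \<sigma> m x - \<sigma> n x) e" if "M \<le> m" "M \<le> n" for m n
      using M[OF that] james_norm_le_iff[OF james_space_diff[OF \<sigma> \<sigma>], of m n e]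
      by (simp add: james_dist \<sigma> minus_bcontfun.rep_eq)
    then show ?thesis by blast
  qed
  have "Cauchy \<sigma>"
  proof (rule metric_CauchyI)
    fix e :: real assume "0 < e"
    then obtain M where M: "\<And>m n. M \<le> m \<Longrightarrow> M \<le> n \<Longrightarrow> qvar_le (\<lambda>x. \<sigma> m x - \<sigma> n x) (e / 2)"
      using Cauchy_norm[of "e / 2"] by auto
    have "dist (\<sigma> m) (\<sigma> n) < e" if "M \<le> m" "M \<le> n" for m n
    proof -
      have "norm (\<sigma> m - \<sigma> n) \<le> james_norm (\<sigma> m - \<sigma> n)"
        by (intro norm_le_james_norm james_space_diff \<sigma>)
      also have "\<dots> \<le> e / 2"
        using M[OF that] by (intro james_norm_le) (simp add: minus_bcontfun.rep_eq)
      also have "\<dots> < e" using \<open>0 < e\<close> by simp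
      finally show ?thesis by (simp add: dist_norm)
    qed
    then show "\<exists>M. \<forall>m\<ge>M. \<forall>n\<ge>M. dist (\<sigma> m) (\<sigma> n) < e" by blast
  qed
  then obtain f where f: "\<sigma> \<longlonglongrightarrow> f"
    using Cauchy_convergent by (auto simp: convergent_def)
  have pt: "(\<lambda>n. \<sigma> n x) \<longlonglongrightarrow> f x" for x
  proof (rule metric_tendsto_imp_tendsto[OF f])
    show "\<forall>\<^sub>F n in sequentially. dist (\<sigma> n x) (f x) \<le> dist (\<sigma> n) f"
      by (intro always_eventually allI dist_bounded)
  qed
  have conv: "\<exists>M. \<forall>n\<ge>M. qvar_le (\<lambda>x. f x - \<sigma> n x) e" if e: "0 < e" for e
  proof -
    obtain M where M: "\<And>m n. M \<le> m \<Longrightarrow> M \<le> n \<Longrightarrow> qvar_le (\<lambda>x. \<sigma> m x - \<sigma> n x) e"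
      using Cauchy_norm[OF e] by auto
    have "qvar_le (\<lambda>x. f x - \<sigma> n x) e" if "M \<le> n" for n
      by (rule qvar_le_limit[of "\<lambda>m x. \<sigma> m x - \<sigma> n x"])
        (use M[OF _ that] in \<open>auto intro!: tendsto_intros pt eventually_sequentiallyI\<close>)
    then show ?thesis by blast
  qed
  have "f \<in> james_space"
  proof (rule james_spaceI)
    fix t :: real assume "t \<le> 0"
    then show "f t = 0"
      using pt[of t] by (simp add: james_space_left[OF \<sigma>] LIMSEQ_const_iff)
  next
    fix t :: real assume "1 \<le> t"
    then have "(\<lambda>n. \<sigma> n t) = (\<lambda>n. \<sigma> n 1)"
      using james_space_right[OF \<sigma>] by blast
    with pt[of t] show "f t = f 1"
      using LIMSEQ_unique[OF pt[of 1]] by simp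
  next
    fix \<eta> :: real assume "0 < \<eta>"
    then obtain n where n: "qvar_le (\<lambda>x. f x - \<sigma> n x) (\<eta> / 2)"
      using conv[of "\<eta> / 2"] by auto
    obtain u :: "real \<Rightarrow>\<^sub>C real" and L
      where u: "variation_le u L" "qvar_le (\<lambda>x. \<sigma> n x - u x) (\<eta> / 2)"
      using james_space_approx[OF \<sigma>, of "\<eta> / 2" n] \<open>0 < \<eta>\<close> by auto
    show "\<exists>(u :: real \<Rightarrow>\<^sub>C real) L. variation_le u L \<and> qvar_le (\<lambda>x. f x - u x) \<eta>"
      using u(1) qvar_le_add[OF n u(2)] by auto
  qed
  moreover have "\<exists>M. \<forall>n\<ge>M. \<sigma> n \<in> james_space \<and> norm_dist james_space james_norm (\<sigma> n) f < e"
    if "0 < e" for e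
  proof -
    obtain M where M: "\<And>n. M \<le> n \<Longrightarrow> qvar_le (\<lambda>x. f x - \<sigma> n x) (e / 2)"
      using conv[of "e / 2"] \<open>0 < e\<close> by auto
    have "norm_dist james_space james_norm (\<sigma> n) f < e" if "M \<le> n" for n
    proof -
      have "norm_dist james_space james_norm f (\<sigma> n) \<le> e / 2"
        using james_norm_le[of "f - \<sigma> n" "e / 2"] M[OF that] \<open>f \<in> james_space\<close> \<sigma>
        by (simp add: james_dist minus_bcontfun.rep_eq)
      then show ?thesis
        using \<open>0 < e\<close> by (simp add: james.commute[of "\<sigma> n" f])
    qed
    then show ?thesis using \<sigma> by blast
  qed
  ultimately have "limitin james.mtopology \<sigma> f sequentially"
    by (simp add: james.limit_metric_sequentially)
  then show "\<exists>f. limitin james.mtopology \<sigma> f sequentially" ..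
qed

lemma banach_james: "banach_space_on james_space james_norm"
  by (simp add: banach_space_on_def subspace_james_space norm_on_james mcomplete_james)


section \<open>The James function space contains no copy of \<open>l\<^sub>1\<close>\<close>

text \<open>Functions that are uniformly small compared with the oscillation of \<open>G\<close> are almost
  orthogonal to it. For a partition, the mixed term \<open>\<Sum> \<Delta>G \<Delta>g\<close> is estimated after
  replacing \<open>G\<close> by an approximant \<open>u\<close> of variation \<open>L\<close>: the error is at most
  \<open>\<eta> C\<close> by the Cauchy--Schwarz inequality, and
  \<open>\<Sum> \<bar>\<Delta>u \<Delta>g\<bar> \<le> 2 \<epsilon> L\<close>.\<close>

lemma james_norm_almost_pythagoras:
  assumes G: "G \<in> james_space" and "0 < C"
  shows "\<exists>\<epsilon>>0. \<forall>g. qvar_le g C \<and> (\<forall>t. \<bar>g t\<bar> \<le> \<epsilon>) \<longrightarrow>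
    qvar_le (\<lambda>x. G x + g x) (sqrt ((james_norm G)\<^sup>2 + C\<^sup>2 + 1))"
proof -
  \<comment> \<open>Each of the two parts of the mixed term is to be at most 1/4; it occurs twice in the square
    of the sum, which accounts for the summand 1 in the claim.\<close>
  define \<eta> where "\<eta> = 1 / (4 * C)"
  have "0 < \<eta>" using \<open>0 < C\<close> by (simp add: \<eta>_def)
  obtain u :: "real \<Rightarrow>\<^sub>C real" and L
    where u: "variation_le u L" "qvar_le (\<lambda>x. G x - u x) \<eta>"
    using james_space_approx[OF G \<open>0 < \<eta>\<close>] .
  have L: "0 \<le> L" using variation_le_nonneg[OF u(1)] .
  define \<epsilon> where "\<epsilon> = 1 / (8 * (L + 1))"
  have "0 < \<epsilon>" using L by (simp add: \<epsilon>_def)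
  have \<epsilon>L: "2 * \<epsilon> * L \<le> 1 / 4" using L by (simp add: \<epsilon>_def field_simps)
  have "qvar_le (\<lambda>x. G x + g x) (sqrt ((james_norm G)\<^sup>2 + C\<^sup>2 + 1))"
    if g: "qvar_le g C" and small: "\<And>t. \<bar>g t\<bar> \<le> \<epsilon>" for g
    unfolding qvar_le_def
  proof (intro allI impI)
    fix t :: "nat \<Rightarrow> real" and n
    assume t: "mono t"
    define w where "w x = G x - u x" for x
    have sq: "(\<Sum>i<n. (increment h t i)\<^sup>2) \<le> D\<^sup>2" if "qvar_le h D" for h D
      using qvar_leD[OF that t, of n] by (auto simp: quadratic_variation_def L2_set_def intro: sqrt_le_D)
    have "(\<Sum>i<n. \<bar>increment u t i\<bar> * \<bar>increment g t i\<bar>) \<le> (\<Sum>i<n. \<bar>increment u t i\<bar> * (2 * \<epsilon>))"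
    proof (intro sum_mono mult_left_mono)
      fix i show "\<bar>increment g t i\<bar> \<le> 2 * \<epsilon>"
        using small[of "t i"] small[of "t (Suc i)"] by (simp add: increment_def)
    qed simp
    also have "\<dots> \<le> L * (2 * \<epsilon>)"
      using variation_leD[OF u(1) t, of n] \<open>0 < \<epsilon>\<close> by (simp flip: sum_distrib_right)
    finally have 1: "(\<Sum>i<n. \<bar>increment u t i\<bar> * \<bar>increment g t i\<bar>) \<le> 1 / 4"
      using \<epsilon>L by (simp add: mult.commute)
    have "(\<Sum>i<n. \<bar>increment w t i\<bar> * \<bar>increment g t i\<bar>)
        \<le> L2_set (increment w t) {..<n} * L2_set (increment g t) {..<n}"
      by (rule L2_set_mult_ineq)
    also have "\<dots> \<le> \<eta> * C"
      using qvar_leD[OF u(2) t, of n] qvar_leD[OF g t, of n] \<open>0 < \<eta>\<close>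
      unfolding quadratic_variation_def w_def by (intro mult_mono) auto
    finally have 2: "(\<Sum>i<n. \<bar>increment w t i\<bar> * \<bar>increment g t i\<bar>) \<le> 1 / 4"
      using \<open>0 < C\<close> by (simp add: \<eta>_def)
    have "(increment (\<lambda>x. G x + g x) t i)\<^sup>2 \<le> (increment G t i)\<^sup>2 + (increment g t i)\<^sup>2
        + 2 * (\<bar>increment u t i\<bar> * \<bar>increment g t i\<bar> + \<bar>increment w t i\<bar> * \<bar>increment g t i\<bar>)" for i
    proof -
      have sum_G: "increment G t i = increment u t i + increment w t i"
        and sum: "increment (\<lambda>x. G x + g x) t i = increment G t i + increment g t i"
        by (auto simp: increment_def w_def)
      have "increment G t i * increment g t i
          = increment u t i * increment g t i + increment w t i * increment g t i"
        unfolding sum_G by (rule distrib_right)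
      also have "\<dots> \<le> \<bar>increment u t i\<bar> * \<bar>increment g t i\<bar> + \<bar>increment w t i\<bar> * \<bar>increment g t i\<bar>"
        by (intro add_mono) (auto simp flip: abs_mult)
      finally show ?thesis
        unfolding sum power2_sum by simp
    qed
    then have "(\<Sum>i<n. (increment (\<lambda>x. G x + g x) t i)\<^sup>2)
      \<le> (\<Sum>i<n. (increment G t i)\<^sup>2 + (increment g t i)\<^sup>2
        + 2 * (\<bar>increment u t i\<bar> * \<bar>increment g t i\<bar> + \<bar>increment w t i\<bar> * \<bar>increment g t i\<bar>))"
      by (rule sum_mono)
    also have "\<dots> = (\<Sum>i<n. (increment G t i)\<^sup>2) + (\<Sum>i<n. (increment g t i)\<^sup>2)
        + 2 * ((\<Sum>i<n. \<bar>increment u t i\<bar> * \<bar>increment g t i\<bar>)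
          + (\<Sum>i<n. \<bar>increment w t i\<bar> * \<bar>increment g t i\<bar>))"
      by (simp only: sum.distrib sum_distrib_left distrib_left)
    also have "\<dots> \<le> (james_norm G)\<^sup>2 + C\<^sup>2 + 2 * (1 / 4 + 1 / 4)"
      by (intro add_mono mult_left_mono sq qvar_le_james_norm[OF G] g 1 2) simp
    finally show "quadratic_variation (\<lambda>x. G x + g x) t n \<le> sqrt ((james_norm G)\<^sup>2 + C\<^sup>2 + 1)"
      unfolding quadratic_variation_def L2_set_def by (intro real_sqrt_le_mono) simp
  qed
  then show ?thesis
    using \<open>0 < \<epsilon>\<close> by blast
qed

lemma finite_support_l1:
  assumes "\<And>i. k \<le> i \<Longrightarrow> a i = 0"
  shows "a \<in> l1_space" "l1_norm a = (\<Sum>i<k. \<bar>a i\<bar>)"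
proof -
  have "a i = 0" if "i \<notin> {..<k}" for i
    using assms that by simp
  then show "a \<in> l1_space" "l1_norm a = (\<Sum>i<k. \<bar>a i\<bar>)"
    unfolding l1_space_def l1_norm_def mem_Collect_eq
    by (intro summable_finite[of "{..<k}"] suminf_finite; simp)+
qed

text \<open>Suppose that \<open>J\<close> embeds \<open>l\<^sub>1\<close>. Given a finitely supported \<open>a\<close>, a signed
  average \<open>b\<close> of later unit vectors has \<open>l\<^sub>1\<close> norm 1, and by
  \<open>signed_average_uniformly_small\<close> the signs can be chosen so that \<open>J b\<close> is uniformly
  so small that it is almost orthogonal to \<open>J a\<close>. Repeating this \<open>n\<close> times yields a vector
  of \<open>l\<^sub>1\<close> norm \<open>n\<close> whose image has norm of order \<open>\<surd>n\<close> only.\<close>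

lemma james_no_l1: "\<not> contains_l1 james_space james_norm"
proof
  assume "contains_l1 james_space james_norm"
  then obtain J c C where maps: "J \<in> l1_space \<rightarrow> james_space"
    and additive: "\<forall>a\<in>l1_space. \<forall>b\<in>l1_space. J (\<lambda>n. a n + b n) = J a + J b"
    and homogeneous: "\<forall>r. \<forall>a\<in>l1_space. J (\<lambda>n. r * a n) = r *\<^sub>R J a"
    and c: "0 < c"
    and bounds: "\<forall>a\<in>l1_space. c * l1_norm a \<le> james_norm (J a) \<and> james_norm (J a) \<le> C * l1_norm a"
    unfolding contains_l1_def by (elim exE conjE)
  have J: "J a \<in> james_space" if "a \<in> l1_space" for a
    using maps that by blast
  have add: "J (\<lambda>n. a n + b n) = J a + J b" if "a \<in> l1_space" "b \<in> l1_space" for a b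
    using additive that by blast
  have scale: "J (\<lambda>n. r * a n) = r *\<^sub>R J a" if "a \<in> l1_space" for r a
    using homogeneous that by blast
  have lower: "c * l1_norm a \<le> james_norm (J a)" if "a \<in> l1_space" for a
    using bounds that by blast
  have upper: "james_norm (J a) \<le> C * l1_norm a" if "a \<in> l1_space" for a
    using bounds that by blast
  define e :: "nat \<Rightarrow> nat \<Rightarrow> real" where "e n i = (if i = n then 1 else 0)" for n i
  have e: "e n \<in> l1_space" "l1_norm (e n) = 1" for n
    using finite_support_l1[of "Suc n" "e n"] by (auto simp: e_def)
  have "0 < C"
    using lower[OF e(1)] upper[OF e(1)] c by (simp add: e(2)) (meson less_le_trans order_trans)
  have qvar_J: "qvar_le (J a) C" if "a \<in> l1_space" "l1_norm a = 1" for a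
    using upper[OF that(1)] that by (simp add: james_norm_le_iff J)
  define block where "block r k m i = (\<Sum>n<m. r n * e (k + n) i)"
    for r :: "nat \<Rightarrow> real" and k m i :: nat
  have block_below: "block r k m i = 0" if "i < k" for r k m i
    using that by (auto simp: block_def e_def)
  have block_above: "block r k m i = 0" if "k + m \<le> i" for r k m i
    using that by (auto simp: block_def e_def)
  have block_at: "block r k m (k + n) = r n" if "n < m" for r k m n
    using that by (simp add: block_def e_def if_distrib cong: if_cong)
  have block_l1: "block r k m \<in> l1_space" for r k m
    using finite_support_l1(1) block_above by blast
  have J_block: "J (block r k m) t = (\<Sum>n<m. r n * J (e (k + n)) t)" for r k m t
  proof (induction m)
    case 0
    have "block r k 0 = (\<lambda>i. 0 * e 0 i)" by (simp add: block_def fun_eq_iff)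
    then show ?case using scale[OF e(1), of 0 0] by simp
  next
    case (Suc m)
    define d where "d = block (\<lambda>_. r m) (k + m) 1"
    have "block r k (Suc m) = (\<lambda>i. block r k m i + d i)"
      by (simp add: d_def block_def fun_eq_iff)
    moreover have "J (\<lambda>i. block r k m i + d i) = J (block r k m) + J d"
      by (intro add) (simp_all only: d_def block_l1)
    moreover have "d = (\<lambda>i. r m * e (k + m) i)"
      by (simp add: d_def block_def fun_eq_iff)
    ultimately have "J (block r k (Suc m)) = J (block r k m) + r m *\<^sub>R J (e (k + m))"
      using scale[OF e(1)] by simp
    then show ?case using Suc by simp
  qed
  have split: "(\<Sum>i<k + m. h i) = (\<Sum>i<k. h i) + (\<Sum>n<m. h (k + n))"
    for h :: "nat \<Rightarrow> real" and k m
    by (induction m) simp_all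
  have "\<exists>a k. (\<forall>i\<ge>k. a i = 0) \<and> l1_norm a = real n \<and> (james_norm (J a))\<^sup>2 \<le> real n * (C\<^sup>2 + 1)"
    for n :: nat
  proof (induction n)
    case 0
    define z where "z = block (\<lambda>_. 0) 0 0"
    have z: "z \<in> l1_space" "z i = 0" for i
      by (simp_all add: z_def block_l1 block_above)
    have "l1_norm z = 0"
      by (simp add: l1_norm_def z(2))
    then have "james_norm (J z) = 0"
      using lower[OF z(1)] upper[OF z(1)] by simp
    then show ?case
      using \<open>l1_norm z = 0\<close> by (intro exI[of _ z] exI[of _ 0] conjI allI impI z(2)) simp_all
  next
    case (Suc n)
    then obtain a k where a: "\<And>i. k \<le> i \<Longrightarrow> a i = 0" "l1_norm a = real n"
      "(james_norm (J a))\<^sup>2 \<le> real n * (C\<^sup>2 + 1)" by blast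
    have "a \<in> l1_space" by (rule finite_support_l1(1)[OF a(1)])
    then obtain \<epsilon> where "0 < \<epsilon>" and \<epsilon>: "\<And>g. qvar_le g C \<Longrightarrow> (\<And>t. \<bar>g t\<bar> \<le> \<epsilon>) \<Longrightarrow>
        qvar_le (\<lambda>x. J a x + g x) (sqrt ((james_norm (J a))\<^sup>2 + C\<^sup>2 + 1))"
      using james_norm_almost_pythagoras[OF J \<open>0 < C\<close>] by metis
    have "qvar_le (J (e (k + i))) C" for i
      by (rule qvar_J[OF e])
    moreover have "\<bar>J (e (k + i)) t\<bar> \<le> C" for i t
      using abs_le_james_norm[OF J[OF e(1)]] upper[OF e(1)] e(2) by (metis mult.right_neutral order_trans)
    ultimately obtain m s where m: "0 < m" and s: "\<And>i. \<bar>s i\<bar> = 1"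
      and small: "\<And>t. \<bar>(\<Sum>i<m. s i * J (e (k + i)) t) / real m\<bar> \<le> \<epsilon>"
      using signed_average_uniformly_small[of "\<lambda>i. J (e (k + i))" C, OF _ _ \<open>0 < \<epsilon>\<close>] by blast
    define b where "b = block (\<lambda>i. s i / real m) k m"
    have b: "b \<in> l1_space" by (simp add: b_def block_l1)
    have "(\<Sum>i<m. \<bar>b (k + i)\<bar>) = (\<Sum>i<m. 1 / real m)"
      by (intro sum.cong refl) (simp add: b_def block_at s)
    then have sum_b: "(\<Sum>i<m. \<bar>b (k + i)\<bar>) = 1"
      using m by simp
    have "l1_norm b = 1"
      using finite_support_l1(2)[of "k + m" b] block_above sum_b
      by (simp add: b_def split block_below)
    then have "qvar_le (J b) C" using qvar_J b by blast
    moreover have "\<bar>J b t\<bar> \<le> \<epsilon>" for t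
      using small[of t] by (simp add: b_def J_block sum_divide_distrib)
    ultimately have "qvar_le (\<lambda>x. J a x + J b x) (sqrt ((james_norm (J a))\<^sup>2 + C\<^sup>2 + 1))"
      by (rule \<epsilon>)
    then have "james_norm (J (\<lambda>i. a i + b i)) \<le> sqrt ((james_norm (J a))\<^sup>2 + C\<^sup>2 + 1)"
      using add[OF \<open>a \<in> l1_space\<close> b] by (intro james_norm_le) (simp add: plus_bcontfun.rep_eq)
    moreover have ab: "\<And>i. k + m \<le> i \<Longrightarrow> a i + b i = 0"
      using a(1) block_above by (simp add: b_def)
    then have "0 \<le> james_norm (J (\<lambda>i. a i + b i))"
      by (intro qvar_le_nonneg[OF qvar_le_james_norm] J finite_support_l1(1))
    ultimately have "(james_norm (J (\<lambda>i. a i + b i)))\<^sup>2 \<le> (sqrt ((james_norm (J a))\<^sup>2 + C\<^sup>2 + 1))\<^sup>2"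
      by (intro power_mono)
    also have "\<dots> = (james_norm (J a))\<^sup>2 + C\<^sup>2 + 1"
      by simp
    also have "\<dots> \<le> real (Suc n) * (C\<^sup>2 + 1)"
      using a(3) by (simp add: algebra_simps)
    finally have "(james_norm (J (\<lambda>i. a i + b i)))\<^sup>2 \<le> real (Suc n) * (C\<^sup>2 + 1)" .
    moreover have "l1_norm (\<lambda>i. a i + b i) = real (Suc n)"
    proof -
      have "l1_norm (\<lambda>i. a i + b i) = (\<Sum>i<k + m. \<bar>a i + b i\<bar>)"
        by (rule finite_support_l1(2)[OF ab])
      also have "\<dots> = (\<Sum>i<k. \<bar>a i\<bar>) + (\<Sum>i<m. \<bar>b (k + i)\<bar>)"
        using a(1) by (simp add: split b_def block_below)
      also have "(\<Sum>i<k. \<bar>a i\<bar>) = real n"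
        using finite_support_l1(2)[OF a(1)] a(2) by simp
      finally show ?thesis using sum_b by simp
    qed
    ultimately show ?case
      using ab by (intro exI[of _ "\<lambda>i. a i + b i"] exI[of _ "k + m"]) blast
  qed
  note long_vectors = this
  obtain n :: nat where n: "(C\<^sup>2 + 1) / c\<^sup>2 < real n"
    using reals_Archimedean2 by blast
  then have "0 < real n" using c by (smt (verit) divide_nonneg_nonneg zero_le_power2)
  obtain a k where a: "\<And>i. k \<le> i \<Longrightarrow> a i = 0" "l1_norm a = real n"
      "(james_norm (J a))\<^sup>2 \<le> real n * (C\<^sup>2 + 1)"
    using long_vectors[of n] by blast
  have "a \<in> l1_space" by (rule finite_support_l1(1)[OF a(1)])
  then have "c * real n \<le> james_norm (J a)"
    using lower a(2) by metis
  then have "(c * real n)\<^sup>2 \<le> (james_norm (J a))\<^sup>2"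
    using c by (intro power_mono) auto
  with a(3) have "real n * (c\<^sup>2 * real n) \<le> real n * (C\<^sup>2 + 1)"
    by (simp add: power2_eq_square algebra_simps)
  then have "c\<^sup>2 * real n \<le> C\<^sup>2 + 1"
    using \<open>0 < real n\<close> by (simp only: mult_le_cancel_left_pos)
  moreover have "C\<^sup>2 + 1 < c\<^sup>2 * real n"
    using n c by (simp add: divide_less_eq mult.commute)
  ultimately show False by simp
qed

lemma rosenthal_james: "rosenthal_space james_space james_norm"
  by (simp add: rosenthal_space_def banach_james james_no_l1)


section \<open>The action on the James function space\<close>

definition increasing_homeo :: "(real \<Rightarrow> real) \<Rightarrow> bool" where
  "increasing_homeo k \<longleftrightarrow>
     bij_betw k {0..1} {0..1} \<and> continuous_on {0..1} k \<and> strict_mono_on {0..1} k"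

lemma H_plus_increasing_homeo:
  assumes "g \<in> H_plus" shows "increasing_homeo g"
proof -
  have "continuous_map (top_of_set {0..1}) (top_of_set {0..1}) g"
    using assms by (intro homeomorphic_imp_continuous_map) (simp add: H_plus_def)
  then have "continuous_on {0..1} g"
    by (simp add: continuous_map_in_subtopology)
  then show ?thesis
    using assms by (simp add: increasing_homeo_def H_plus_def Bij_def)
qed

lemma increasing_homeo_inverse:
  assumes k: "increasing_homeo k" shows "increasing_homeo (inv_into {0..1} k)"
proof -
  have bij: "bij_betw k {0..1} {0..1}" and cont: "continuous_on {0..1} k"
    and mono: "strict_mono_on {0..1} k"
    using k by (auto simp: increasing_homeo_def)
  have "continuous_on (k ` {0..1}) (inv_into {0..1} k)"
    using bij by (intro continuous_on_inv[OF cont]) (auto simp: bij_betw_def)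
  then have "continuous_on {0..1} (inv_into {0..1} k)"
    using bij by (simp add: bij_betw_def)
  moreover have "inv_into {0..1} k s < inv_into {0..1} k t"
    if "s \<in> {0..1}" "t \<in> {0..1}" "s < t" for s t
  proof (rule ccontr)
    assume "\<not> ?thesis"
    then have "k (inv_into {0..1} k t) \<le> k (inv_into {0..1} k s)"
      using bij_betwE[OF bij_betw_inv_into[OF bij]] that mono
      by (intro strict_mono_on_leD[OF mono]) auto
    then show False
      using bij_betw_inv_into_right[OF bij] that by simp
  qed
  ultimately show ?thesis
    using bij_betw_inv_into[OF bij] by (auto simp: increasing_homeo_def intro: strict_mono_onI)
qed

definition unit_clamp :: "real \<Rightarrow> real" where
  "unit_clamp t = max 0 (min 1 t)"

lemma unit_clamp_in [simp]: "unit_clamp t \<in> {0..1}" "0 \<le> unit_clamp t" "unit_clamp t \<le> 1"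
  by (auto simp: unit_clamp_def)

lemma unit_clamp_id [simp]: "t \<in> {0..1} \<Longrightarrow> unit_clamp t = t"
  by (auto simp: unit_clamp_def)

lemma james_space_unit_clamp:
  assumes "f \<in> james_space" shows "f (unit_clamp t) = f t"
  using james_space_left[OF assms, of t] james_space_left[OF assms, of 0]
    james_space_right[OF assms, of t]
  by (cases "t \<le> 0"; cases "1 \<le> t") (auto simp: unit_clamp_def)

text \<open>The values outside the interval are produced by clamping, so a map of the interval acts on
  functions on the line.\<close>

definition reparam :: "(real \<Rightarrow> real) \<Rightarrow> real \<Rightarrow> real" where
  "reparam k t = k (unit_clamp t)"

definition pullback :: "(real \<Rightarrow> real) \<Rightarrow> (real \<Rightarrow>\<^sub>C real) \<Rightarrow> (real \<Rightarrow>\<^sub>C real)" where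
  "pullback k f = Bcontfun (\<lambda>t. f (reparam k t))"

context
  fixes k assumes k: "increasing_homeo k"
begin

lemma increasing_homeo_in: "t \<in> {0..1} \<Longrightarrow> k t \<in> {0..1}"
  using k by (auto simp: increasing_homeo_def bij_betw_def)

lemma reparam_in: "reparam k t \<in> {0..1}"
  unfolding reparam_def by (intro increasing_homeo_in) simp

lemma mono_reparam: "mono (reparam k)"
proof (rule monoI)
  fix s t :: real assume "s \<le> t"
  then have "unit_clamp s \<le> unit_clamp t" by (auto simp: unit_clamp_def)
  then show "reparam k s \<le> reparam k t"
    using k unfolding reparam_def increasing_homeo_def
    by (intro strict_mono_on_leD[of "{0..1}" k]) auto
qed

lemma increasing_homeo_endpoints: "k 0 = 0" "k 1 = 1"
proof -
  have surj: "k ` {0..1} = {0..1}" and mono: "strict_mono_on {0..1} k"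
    using k by (auto simp: increasing_homeo_def bij_betw_def)
  have "0 \<in> k ` {0..1}" "1 \<in> k ` {0..1}"
    unfolding surj by auto
  then obtain s t where "s \<in> {0..1}" "k s = 0" "t \<in> {0..1}" "k t = 1"
    by (metis imageE)
  moreover have "k 0 \<le> k r" "k r \<le> k 1" if "r \<in> {0..1}" for r
    using that by (auto intro!: strict_mono_on_leD[OF mono])
  moreover have "0 \<le> k 0" "k 1 \<le> 1"
    using increasing_homeo_in[of 0] increasing_homeo_in[of 1] by auto
  ultimately show "k 0 = 0" "k 1 = 1"
    by (metis order_antisym)+
qed

lemma reparam_left: "t \<le> 0 \<Longrightarrow> reparam k t = 0"
  using increasing_homeo_endpoints by (simp add: reparam_def unit_clamp_def)

lemma reparam_right: "1 \<le> t \<Longrightarrow> reparam k t = 1"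
  using increasing_homeo_endpoints by (simp add: reparam_def unit_clamp_def)

lemma continuous_reparam: "continuous_on UNIV (reparam k)"
proof -
  have "continuous_on UNIV unit_clamp"
    unfolding unit_clamp_def by (intro continuous_intros)
  moreover have "continuous_on {0..1} k"
    using k by (simp add: increasing_homeo_def)
  ultimately have "continuous_on UNIV (\<lambda>t. k (unit_clamp t))"
    by (intro continuous_on_compose2[of "{0..1}" k UNIV unit_clamp]) auto
  then show ?thesis
    by (simp add: reparam_def[abs_def])
qed

lemma pullback_apply [simp]: "pullback k f t = f (reparam k t)"
proof -
  have "(\<lambda>t. f (reparam k t)) \<in> bcontfun"
  proof (rule bcontfun_normI)
    show "continuous_on UNIV (\<lambda>t. f (reparam k t))"
      by (rule continuous_on_compose2[OF continuous_on_apply_bcontfun continuous_reparam]) auto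
    show "norm (f (reparam k t)) \<le> norm f" for t
      by (rule norm_bounded)
  qed
  then show ?thesis
    by (simp add: pullback_def Bcontfun_inverse)
qed

lemma pullback_linear:
  "pullback k (f + g) = pullback k f + pullback k g"
  "pullback k (r *\<^sub>R f) = r *\<^sub>R pullback k f"
  by (auto intro: bcontfun_eqI)

lemma pullback_james_space:
  assumes "f \<in> james_space" shows "pullback k f \<in> james_space"
proof (rule james_spaceI)
  fix t :: real
  show "pullback k f t = 0" if "t \<le> 0"
    using that james_space_left[OF assms] by (simp add: reparam_left)
  show "pullback k f t = pullback k f 1" if "1 \<le> t"
    using that by (simp add: reparam_right)
next
  fix \<eta> :: real assume "0 < \<eta>"
  then obtain u :: "real \<Rightarrow>\<^sub>C real" and L
    where u: "variation_le u L" "qvar_le (\<lambda>x. f x - u x) \<eta>"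
    using james_space_approx[OF assms] by blast
  have "variation_le (pullback k u) L"
    using variation_le_reparametrize[OF u(1) mono_reparam] by (simp add: variation_le_def increment_def)
  moreover have "qvar_le (\<lambda>x. pullback k f x - pullback k u x) \<eta>"
    using qvar_le_reparametrize[OF u(2) mono_reparam] by simp
  ultimately show "\<exists>(u :: real \<Rightarrow>\<^sub>C real) L. variation_le u L \<and> qvar_le (\<lambda>x. pullback k f x - u x) \<eta>"
    by blast
qed

lemma james_norm_pullback_le:
  assumes "f \<in> james_space" shows "james_norm (pullback k f) \<le> james_norm f"
proof (rule james_norm_le)
  have "apply_bcontfun (pullback k f) = (\<lambda>x. f (reparam k x))"
    by (simp add: fun_eq_iff)
  then show "qvar_le (pullback k f) (james_norm f)"
    using qvar_le_reparametrize[OF qvar_le_james_norm[OF assms] mono_reparam] by simp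
qed

lemma inv_into_increasing_homeo:
  assumes "t \<in> {0..1}"
  shows "k (inv_into {0..1} k t) = t" "inv_into {0..1} k (k t) = t"
  using k assms bij_betw_inv_into_left[of k "{0..1}" "{0..1}"]
    bij_betw_inv_into_right[of k "{0..1}" "{0..1}"]
  by (auto simp: increasing_homeo_def)

end

lemma pullback_inverse:
  assumes "increasing_homeo k" "f \<in> james_space"
  shows "pullback (inv_into {0..1} k) (pullback k f) = f"
    and "pullback k (pullback (inv_into {0..1} k) f) = f"
proof -
  note ih = increasing_homeo_inverse[OF assms(1)]
  have "reparam k (reparam (inv_into {0..1} k) t) = unit_clamp t"
    "reparam (inv_into {0..1} k) (reparam k t) = unit_clamp t" for t
    using increasing_homeo_in[OF assms(1), of "unit_clamp t"]
      increasing_homeo_in[OF ih, of "unit_clamp t"]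
    by (simp_all add: reparam_def inv_into_increasing_homeo[OF assms(1)])
  then show "pullback (inv_into {0..1} k) (pullback k f) = f"
    and "pullback k (pullback (inv_into {0..1} k) f) = f"
    by (auto intro!: bcontfun_eqI simp: pullback_apply[OF assms(1)] pullback_apply[OF ih]
        james_space_unit_clamp[OF assms(2)])
qed

lemma james_norm_pullback:
  assumes "increasing_homeo k" "f \<in> james_space"
  shows "james_norm (pullback k f) = james_norm f"
proof (rule antisym)
  show "james_norm (pullback k f) \<le> james_norm f"
    by (rule james_norm_pullback_le[OF assms])
  have "james_norm (pullback (inv_into {0..1} k) (pullback k f)) \<le> james_norm (pullback k f)"
    by (intro james_norm_pullback_le increasing_homeo_inverse pullback_james_space assms)
  then show "james_norm f \<le> james_norm (pullback k f)"
    by (simp add: pullback_inverse[OF assms])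
qed

text \<open>Composing with the inverse makes this a left action.\<close>

definition james_action :: "(real \<Rightarrow> real) \<Rightarrow> (real \<Rightarrow>\<^sub>C real) \<Rightarrow> (real \<Rightarrow>\<^sub>C real)" where
  "james_action g = (\<lambda>f\<in>james_space. pullback (inv_into {0..1} g) f)"

lemma james_action_isometry:
  assumes "g \<in> H_plus" shows "james_action g \<in> isometries james_space james_norm"
proof -
  note h = H_plus_increasing_homeo[OF assms]
  note ih = increasing_homeo_inverse[OF h]
  have "bij_betw (pullback (inv_into {0..1} g)) james_space james_space"
    by (rule bij_betw_byWitness[where f' = "pullback g"])
      (auto simp: pullback_inverse[OF h] pullback_james_space[OF h] pullback_james_space[OF ih])
  then have "bij_betw (james_action g) james_space james_space"
    unfolding james_action_def by (simp add: bij_betw_restrict_eq)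
  then show ?thesis
    using subspace_james_space
    by (auto simp: isometries_def Bij_def james_action_def pullback_linear[OF ih]
        james_norm_pullback[OF ih] subspace_add subspace_mul)
qed

lemma james_action_in:
  "g \<in> H_plus \<Longrightarrow> f \<in> james_space \<Longrightarrow> james_action g f \<in> james_space"
  by (simp add: james_action_def pullback_james_space increasing_homeo_inverse H_plus_increasing_homeo)

lemma james_action_hom: "james_action \<in> hom H_plus_group (Iso_group james_space james_norm)"
proof (rule homI)
  fix g assume "g \<in> carrier H_plus_group"
  then show "james_action g \<in> carrier (Iso_group james_space james_norm)"
    by (simp add: H_plus_group_def Iso_group_def james_action_isometry)
next
  fix g h assume "g \<in> carrier H_plus_group" "h \<in> carrier H_plus_group"
  then have gh: "g \<in> H_plus" "h \<in> H_plus"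
    by (auto simp: H_plus_group_def)
  then have Bij: "g \<in> Bij {0..1}" "h \<in> Bij {0..1}"
    by (auto simp: H_plus_def)
  have Bij': "james_action g \<in> Bij james_space" "james_action h \<in> Bij james_space"
    using gh[THEN james_action_isometry] by (auto simp: isometries_def)
  note g = H_plus_increasing_homeo[OF gh(1)] and h = H_plus_increasing_homeo[OF gh(2)]
  note ig = increasing_homeo_inverse[OF g] and ih = increasing_homeo_inverse[OF h]
  have inv: "inv_into {0..1} (compose {0..1} g h) s = inv_into {0..1} h (inv_into {0..1} g s)"
    if "s \<in> {0..1}" for s
  proof (rule inv_into_f_eq)
    show "inj_on (compose {0..1} g h) {0..1}"
      using compose_Bij[OF Bij] by (auto simp: Bij_def bij_betw_def)
    show "inv_into {0..1} h (inv_into {0..1} g s) \<in> {0..1}"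
      by (intro increasing_homeo_in[OF ih] increasing_homeo_in[OF ig] that)
    then show "compose {0..1} g h (inv_into {0..1} h (inv_into {0..1} g s)) = s"
      using that by (simp add: compose_def inv_into_increasing_homeo[OF g]
          inv_into_increasing_homeo[OF h] increasing_homeo_in[OF ig] del: atLeastAtMost_iff)
  qed
  have "reparam (inv_into {0..1} (compose {0..1} g h)) t
      = reparam (inv_into {0..1} h) (reparam (inv_into {0..1} g) t)" for t
    using increasing_homeo_in[OF ig, of "unit_clamp t"] by (simp add: reparam_def inv)
  then have "pullback (inv_into {0..1} (compose {0..1} g h)) f
      = pullback (inv_into {0..1} g) (pullback (inv_into {0..1} h) f)" for f
    unfolding pullback_def[of "inv_into {0..1} (compose {0..1} g h)"]
      pullback_def[of "inv_into {0..1} g"]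
    by (simp add: pullback_apply[OF ih])
  then have "james_action (compose {0..1} g h) = compose james_space (james_action g) (james_action h)"
    by (auto simp: james_action_def compose_def fun_eq_iff pullback_james_space[OF ih])
  then show "james_action (g \<otimes>\<^bsub>H_plus_group\<^esub> h)
      = james_action g \<otimes>\<^bsub>Iso_group james_space james_norm\<^esub> james_action h"
    using Bij Bij' by (simp add: H_plus_group_def Iso_group_def BijGroup_def)
qed


section \<open>Comparison of the topologies\<close>

lemma topspace_H_plus [simp]: "topspace H_plus_topology = H_plus"
proof -
  have "H_plus = {g \<in> H_plus. g ` {} \<subseteq> {}}" by simp
  moreover have "compactin (top_of_set {0..1::real}) {}" "openin (top_of_set {0..1::real}) {}"
    by auto
  ultimately show ?thesis
    unfolding H_plus_topology_def topology_generated_by_topspace by blast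
qed

lemma openin_H_plus_point:
  assumes "t \<in> {0..1}" "open U"
  shows "openin H_plus_topology {g \<in> H_plus. g t \<in> U}"
  unfolding H_plus_topology_def
proof (rule topology_generated_by_Basis)
  have "{g \<in> H_plus. g t \<in> U} = {g \<in> H_plus. g ` {t} \<subseteq> {0..1} \<inter> U}"
    using increasing_homeo_in[OF H_plus_increasing_homeo assms(1)] by auto
  moreover have "compactin (top_of_set {0..1}) {t}"
    using assms(1) by (simp add: compactin_subtopology)
  moreover have "openin (top_of_set {0..1}) ({0..1} \<inter> U)"
    using assms(2) by (simp add: openin_open_Int)
  ultimately show "{g \<in> H_plus. g t \<in> U} \<in> {{g \<in> H_plus. g ` K \<subseteq> U} | K U.
        compactin (top_of_set {0..1}) K \<and> openin (top_of_set {0..1}) U}"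
    by blast
qed

text \<open>The compact-open topology is coarser than that of uniform convergence: the compact set
  \<open>g ` K\<close> has positive distance from the complement of \<open>U\<close>.\<close>

lemma H_plus_open_contains_uniform_ball:
  assumes "openin H_plus_topology W" "g \<in> W"
  shows "\<exists>\<epsilon>>0. \<forall>h\<in>H_plus. (\<forall>t\<in>{0..1}. \<bar>h t - g t\<bar> < \<epsilon>) \<longrightarrow> h \<in> W"
proof -
  have "generate_topology_on {{g \<in> H_plus. g ` K \<subseteq> U} | K U.
     compactin (top_of_set {0..1}) K \<and> openin (top_of_set {0..1}) U} W"
    using assms(1) by (simp add: H_plus_topology_def openin_topology_generated_by_iff)
  from this assms(2) show ?thesis
  proof (induction arbitrary: g)
    case Empty
    then show ?case by simp
  next
    case (Int V W)
    obtain \<delta> where "0 < \<delta>" "\<forall>h\<in>H_plus. (\<forall>t\<in>{0..1}. \<bar>h t - g t\<bar> < \<delta>) \<longrightarrow> h \<in> V"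
      using Int by (meson IntD1)
    moreover obtain \<epsilon> where "0 < \<epsilon>" "\<forall>h\<in>H_plus. (\<forall>t\<in>{0..1}. \<bar>h t - g t\<bar> < \<epsilon>) \<longrightarrow> h \<in> W"
      using Int by (meson IntD2)
    ultimately show ?case
      by (intro exI[of _ "min \<delta> \<epsilon>"]) simp
  next
    case (UN K)
    then show ?case by (meson Union_iff)
  next
    case (Basis W)
    then obtain K U where W: "W = {g \<in> H_plus. g ` K \<subseteq> U}"
      and K: "compactin (top_of_set {0..1}) K" and U: "openin (top_of_set {0..1}) U"
      by blast
    obtain U' where U': "open U'" "U = {0..1} \<inter> U'"
      using U by (auto simp: openin_open)
    have K': "compact K" "K \<subseteq> {0..1}"
      using K by (auto simp: compactin_subtopology)
    have g: "increasing_homeo g" "g ` K \<subseteq> U"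
      using Basis W H_plus_increasing_homeo by auto
    then have "compact (g ` K)"
      using K' by (intro compact_continuous_image) (auto simp: increasing_homeo_def intro: continuous_on_subset)
    then obtain \<epsilon> where "0 < \<epsilon>" and \<epsilon>: "(\<Union>x\<in>g ` K. ball x \<epsilon>) \<subseteq> U'"
      using compact_subset_open_imp_ball_epsilon_subset[of "g ` K" U'] U' g(2) by blast
    have "h \<in> W" if "h \<in> H_plus" and close: "\<forall>t\<in>{0..1}. \<bar>h t - g t\<bar> < \<epsilon>" for h
    proof -
      have "h t \<in> U" if "t \<in> K" for t
      proof -
        have "t \<in> {0..1}" using K'(2) that by blast
        then have "h t \<in> ball (g t) \<epsilon>"
          using close by (simp add: dist_real_def abs_minus_commute)
        then have "h t \<in> U'" using \<epsilon> that by blast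
        then show ?thesis
          using U'(2) increasing_homeo_in[OF H_plus_increasing_homeo[OF \<open>h \<in> H_plus\<close>] \<open>t \<in> {0..1}\<close>]
          by blast
      qed
      then show ?thesis using W \<open>h \<in> H_plus\<close> by blast
    qed
    then show ?case using \<open>0 < \<epsilon>\<close> by blast
  qed
qed

text \<open>If \<open>y\<close> exceeded \<open>x\<close> by more than \<open>2 / n\<close>, two consecutive grid points would lie
  between \<open>x\<close> and \<open>y\<close>, and the grid hypothesis would give \<open>p x < q y\<close>.\<close>

lemma grid_comparison:
  fixes p q :: "real \<Rightarrow> real"
  assumes p: "strict_mono_on {0..1} p" and q: "strict_mono_on {0..1} q" and n: "0 < n"
    and grid: "\<And>i j. i < j \<Longrightarrow> j \<le> n \<Longrightarrow> p (real i / real n) < q (real j / real n)"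
    and xy: "x \<in> {0..1}" "y \<in> {0..1}" "p x = q y"
  shows "y \<le> x + 2 / real n"
proof (rule ccontr)
  assume "\<not> ?thesis"
  then have far: "x + 2 / real n < y" by simp
  define i where "i = nat \<lceil>real n * x\<rceil>"
  have "real n * x \<le> real i" "real i < real n * x + 1"
    using xy(1) n unfolding i_def by (auto simp: real_nat_ceiling_ge) linarith
  then have i: "x \<le> real i / real n" "real i / real n < x + 1 / real n"
    using n by (auto simp: field_simps)
  have "real (Suc i) / real n = real i / real n + 1 / real n"
    by (simp add: add_divide_distrib)
  also have "\<dots> < x + 2 / real n"
    using i(2) by (simp add: field_simps)
  finally have j: "real (Suc i) / real n < y"
    using far by linarith
  then have "real (Suc i) / real n < 1"
    using xy(2) by simp
  then have "Suc i \<le> n"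
    using n by (simp add: field_simps)
  then have in01: "real i / real n \<in> {0..1}" "real (Suc i) / real n \<in> {0..1}"
    by auto
  have "p x \<le> p (real i / real n)"
    by (rule strict_mono_on_leD[OF p xy(1) in01(1) i(1)])
  also have "\<dots> < q (real (Suc i) / real n)"
    using grid \<open>Suc i \<le> n\<close> by blast
  also have "\<dots> \<le> q y"
    by (rule strict_mono_on_leD[OF q in01(2) xy(2)]) (use j in simp)
  finally show False using xy(3) by simp
qed

text \<open>By monotonicity, evaluation conditions at finitely many grid points control the inverse
  uniformly. Such conditions are open already for pointwise convergence.\<close>

lemma inverses_uniformly_close:
  assumes g: "g \<in> H_plus" and "0 < \<delta>"
  shows "\<exists>W. openin H_plus_topology W \<and> g \<in> W \<and>
    (\<forall>h\<in>W. \<forall>s\<in>{0..1}. \<bar>inv_into {0..1} h s - inv_into {0..1} g s\<bar> < \<delta>)"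
proof -
  obtain n :: nat where n: "2 / \<delta> < real n"
    using reals_Archimedean2 by blast
  then have "0 < real n" using \<open>0 < \<delta>\<close> by (smt (verit) divide_pos_pos)
  then have n0: "0 < n" and \<delta>: "2 / real n < \<delta>"
    using n \<open>0 < \<delta>\<close> by (auto simp: field_simps)
  define I where "I = {(i, j). i < j \<and> j \<le> n}"
  have "I \<subseteq> {..n} \<times> {..n}" by (auto simp: I_def)
  then have "finite I" by (rule finite_subset) simp
  have "I \<noteq> {}" using n0 by (auto simp: I_def)
  define A where "A = (\<lambda>(i, j). {h \<in> H_plus. h (real i / real n) \<in> {..< g (real j / real n)}} \<inter>
     {h \<in> H_plus. h (real j / real n) \<in> {g (real i / real n) <..}})"
  have unit: "real i / real n \<in> {0..1}" if "i \<le> n" for i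
    using that n0 by simp
  have mono: "strict_mono_on {0..1} h" if "h \<in> H_plus" for h
    using that by (simp add: H_plus_def)
  have "openin H_plus_topology (\<Inter>(A ` I))"
    using \<open>finite I\<close> \<open>I \<noteq> {}\<close>
  proof (rule openin_INT2)
    fix ij assume "ij \<in> I"
    then show "openin H_plus_topology (A ij)"
      unfolding A_def I_def
      by (auto intro!: openin_Int openin_H_plus_point unit simp del: lessThan_iff greaterThan_iff atLeastAtMost_iff)
  qed
  moreover have "g \<in> \<Inter>(A ` I)"
  proof (rule INT_I)
    fix ij assume "ij \<in> I"
    then obtain i j where ij: "ij = (i, j)" "i < j" "j \<le> n" by (auto simp: I_def)
    have "g (real i / real n) < g (real j / real n)"
      using ij n0 by (intro strict_mono_onD[OF mono[OF g]] unit) (auto simp: divide_strict_right_mono)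
    then show "g \<in> A ij"
      using g by (simp add: A_def ij)
  qed
  moreover have "\<bar>inv_into {0..1} h s - inv_into {0..1} g s\<bar> < \<delta>"
    if h: "h \<in> \<Inter>(A ` I)" and s: "s \<in> {0..1}" for h s
  proof -
    have grid: "h \<in> A (i, j)" if "i < j" "j \<le> n" for i j
      using h that by (auto simp: I_def)
    have hH: "h \<in> H_plus" using grid[of 0 n] n0 by (auto simp: A_def)
    note hg = H_plus_increasing_homeo[OF hH] H_plus_increasing_homeo[OF g]
    note inv_in = hg[THEN increasing_homeo_inverse, THEN increasing_homeo_in, OF s]
    have eq: "h (inv_into {0..1} h s) = g (inv_into {0..1} g s)"
      using hg[THEN inv_into_increasing_homeo(1), OF s] by simp
    have "inv_into {0..1} g s \<le> inv_into {0..1} h s + 2 / real n"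
      by (rule grid_comparison[OF mono[OF hH] mono[OF g] n0 _ inv_in eq])
        (use grid in \<open>auto simp: A_def\<close>)
    moreover have "inv_into {0..1} h s \<le> inv_into {0..1} g s + 2 / real n"
      by (rule grid_comparison[OF mono[OF g] mono[OF hH] n0 _ inv_in(2,1) eq[symmetric]])
        (use grid in \<open>auto simp: A_def\<close>)
    ultimately show ?thesis using \<delta> by linarith
  qed
  ultimately show ?thesis by blast
qed

text \<open>Writing \<open>f = u + (f - u)\<close> with \<open>u\<close> of bounded variation, the part \<open>f - u\<close> contributes
  at most \<open>2 \<eta>\<close> whatever \<open>h\<close> is, and \<open>u \<circ> g\<^sup>-\<^sup>1 - u \<circ> h\<^sup>-\<^sup>1\<close>, whose variation is at most
  \<open>2 L\<close>, is uniformly small when the inverses are close.\<close>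

lemma james_action_continuous_at:
  assumes f: "f \<in> james_space" and g: "g \<in> H_plus" and "0 < r"
  shows "\<exists>W. openin H_plus_topology W \<and> g \<in> W \<and>
    (\<forall>h\<in>W. james_norm (james_action g f - james_action h f) < r)"
proof -
  define \<eta> where "\<eta> = r / 4"
  have \<eta>: "0 < \<eta>" using \<open>0 < r\<close> by (simp add: \<eta>_def)
  obtain u :: "real \<Rightarrow>\<^sub>C real" and L
    where u: "variation_le u L" "qvar_le (\<lambda>x. f x - u x) \<eta>"
    using james_space_approx[OF f \<eta>] .
  have L: "0 \<le> L" using variation_le_nonneg[OF u(1)] .
  \<comment> \<open>This choice makes the bound of \<open>qvar_le_sup_variation\<close> for variation \<open>2 L\<close> at most \<open>\<eta>\<close>;
    the 1 only avoids division by 0.\<close>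
  define \<kappa> where "\<kappa> = \<eta>\<^sup>2 / (4 * (L + 1))"
  have "0 < \<kappa>" using \<eta> L by (simp add: \<kappa>_def)
  have "2 * \<kappa> * (L + L) \<le> \<eta>\<^sup>2"
    using \<eta> L by (simp add: \<kappa>_def field_simps)
  then have \<kappa>L: "sqrt (2 * \<kappa> * (L + L)) \<le> \<eta>"
    using \<eta> by (intro real_le_lsqrt) auto
  have "uniformly_continuous_on {0..1} (apply_bcontfun u)"
    by (intro compact_uniformly_continuous) auto
  then obtain \<delta> where "0 < \<delta>" and \<delta>: "\<And>x y. x \<in> {0..1} \<Longrightarrow> y \<in> {0..1} \<Longrightarrow> dist y x < \<delta> \<Longrightarrow> dist (u y) (u x) < \<kappa>"
    unfolding uniformly_continuous_on_def using \<open>0 < \<kappa>\<close> by metis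
  obtain W where W: "openin H_plus_topology W" "g \<in> W"
    and close: "\<And>h s. h \<in> W \<Longrightarrow> s \<in> {0..1} \<Longrightarrow> \<bar>inv_into {0..1} h s - inv_into {0..1} g s\<bar> < \<delta>"
    using inverses_uniformly_close[OF g \<open>0 < \<delta>\<close>] by blast
  have "james_norm (james_action g f - james_action h f) < r" if "h \<in> W" for h
  proof -
    have "h \<in> H_plus" using openin_subset[OF W(1)] that by auto
    define \<phi> \<psi> where "\<phi> = reparam (inv_into {0..1} g)" and "\<psi> = reparam (inv_into {0..1} h)"
    note ig = increasing_homeo_inverse[OF H_plus_increasing_homeo[OF g]]
    note ih = increasing_homeo_inverse[OF H_plus_increasing_homeo[OF \<open>h \<in> H_plus\<close>]]
    have mono: "mono \<phi>" "mono \<psi>"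
      unfolding \<phi>_def \<psi>_def by (rule mono_reparam[OF ig], rule mono_reparam[OF ih])
    have "\<bar>u (\<phi> x) - u (\<psi> x)\<bar> \<le> \<kappa>" for x
    proof -
      have "dist (\<phi> x) (\<psi> x) < \<delta>"
        using close[OF that, of "unit_clamp x"]
        by (simp add: \<phi>_def \<psi>_def reparam_def dist_real_def abs_minus_commute)
      from \<delta>[OF _ _ this] show ?thesis
        using reparam_in[OF ig, of x] reparam_in[OF ih, of x] by (simp add: \<phi>_def \<psi>_def dist_real_def)
    qed
    then have "qvar_le (\<lambda>x. u (\<phi> x) - u (\<psi> x)) (sqrt (2 * \<kappa> * (L + L)))"
      by (intro qvar_le_sup_variation variation_le_diff variation_le_reparametrize[OF u(1)] mono)
    then have "qvar_le (\<lambda>x. u (\<phi> x) - u (\<psi> x)) \<eta>"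
      using \<kappa>L by (rule qvar_le_mono)
    then have "qvar_le (\<lambda>x. (u (\<phi> x) - u (\<psi> x)) + ((f (\<phi> x) - u (\<phi> x)) - (f (\<psi> x) - u (\<psi> x)))) (\<eta> + (\<eta> + \<eta>))"
      by (intro qvar_le_add qvar_le_diff qvar_le_reparametrize[OF u(2)] mono)
    then have "qvar_le (\<lambda>x. f (\<phi> x) - f (\<psi> x)) (\<eta> + (\<eta> + \<eta>))"
      by simp
    moreover have "apply_bcontfun (james_action g f - james_action h f) = (\<lambda>x. f (\<phi> x) - f (\<psi> x))"
      using f by (simp add: fun_eq_iff james_action_def pullback_apply[OF ig] pullback_apply[OF ih] \<phi>_def \<psi>_def)
    ultimately have "james_norm (james_action g f - james_action h f) \<le> \<eta> + (\<eta> + \<eta>)"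
      by (intro james_norm_le) simp
    also have "\<dots> < r" using \<open>0 < r\<close> by (simp add: \<eta>_def)
    finally show ?thesis .
  qed
  then show ?thesis using W by blast
qed

definition homeo_vector :: "(real \<Rightarrow> real) \<Rightarrow> (real \<Rightarrow>\<^sub>C real)" where
  "homeo_vector g = Bcontfun (reparam g)"

lemma homeo_vector_apply:
  assumes "increasing_homeo g" shows "homeo_vector g t = reparam g t"
proof -
  have "reparam g \<in> bcontfun"
    using continuous_reparam[OF assms] reparam_in[OF assms]
    by (intro bcontfun_normI[of _ 1]) auto
  then show ?thesis
    by (simp add: homeo_vector_def Bcontfun_inverse)
qed

lemma homeo_vector_in:
  assumes "increasing_homeo g" shows "homeo_vector g \<in> james_space"
proof (rule james_spaceI_variation)
  have "(\<Sum>i<n. \<bar>increment (homeo_vector g) t i\<bar>) \<le> 1" if "mono t" for t n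
  proof -
    have "(\<Sum>i<n. \<bar>increment (homeo_vector g) t i\<bar>) = (\<Sum>i<n. reparam g (t (Suc i)) - reparam g (t i))"
      using monoD[OF mono_reparam[OF assms]] monoD[OF that]
      by (intro sum.cong refl) (simp add: increment_def homeo_vector_apply[OF assms])
    also have "\<dots> = reparam g (t n) - reparam g (t 0)"
      by (rule sum_lessThan_telescope)
    also have "\<dots> \<le> 1"
      using reparam_in[OF assms, of "t n"] reparam_in[OF assms, of "t 0"] by simp
    finally show ?thesis .
  qed
  then show "variation_le (homeo_vector g) 1"
    by (simp add: variation_le_def)
qed (simp_all add: homeo_vector_apply[OF assms] reparam_left[OF assms] reparam_right[OF assms])

text \<open>The vector \<open>g\<close> is moved to the identity function by \<open>g\<close> itself and to \<open>g \<circ> h\<^sup>-\<^sup>1\<close> by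
  \<open>h\<close>. The difference of the two images takes the value \<open>h t - g t\<close> at the point \<open>h t\<close>, and the
  norm dominates all values.\<close>

lemma uniform_dist_le_orbit_dist:
  assumes "g \<in> H_plus" "h \<in> H_plus" "t \<in> {0..1}"
  shows "\<bar>h t - g t\<bar> \<le> james_norm (james_action g (homeo_vector g) - james_action h (homeo_vector g))"
proof -
  note g = H_plus_increasing_homeo[OF assms(1)] and h = H_plus_increasing_homeo[OF assms(2)]
  note ig = increasing_homeo_inverse[OF g] and ih = increasing_homeo_inverse[OF h]
  define d where "d = james_action g (homeo_vector g) - james_action h (homeo_vector g)"
  have d: "d \<in> james_space"
    unfolding d_def by (intro james_space_diff james_action_in homeo_vector_in g assms)
  have ht: "h t \<in> {0..1}" by (rule increasing_homeo_in[OF h assms(3)])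
  have "d (h t) = h t - g t"
    using ht assms(3) increasing_homeo_in[OF ig ht]
    by (simp add: d_def james_action_def homeo_vector_in[OF g] pullback_apply[OF ig] pullback_apply[OF ih]
        homeo_vector_apply[OF g] reparam_def inv_into_increasing_homeo[OF g] inv_into_increasing_homeo[OF h]
        del: atLeastAtMost_iff)
  then show ?thesis
    using abs_le_james_norm[OF d, of "h t"] by (simp add: d_def)
qed

lemma topspace_james_strong [simp]:
  "topspace (Iso_strong_topology james_space james_norm) = isometries james_space james_norm"
  by (auto simp: Iso_strong_topology_def norm_topology_def isometries_def Bij_def bij_betw_def PiE_def)

lemma openin_james_strong:
  assumes "f \<in> james_space"
  shows "openin (Iso_strong_topology james_space james_norm)
    {T \<in> isometries james_space james_norm. T f \<in> james.mball v r}"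
proof -
  have "continuous_map (Iso_strong_topology james_space james_norm) james.mtopology (\<lambda>T. T f)"
    unfolding Iso_strong_topology_def norm_topology_def
    by (intro continuous_map_from_subtopology continuous_map_product_projection assms)
  from openin_continuous_map_preimage[OF this james.openin_mball, of v r]
  show ?thesis by simp
qed

lemma james_action_continuous:
  "continuous_map H_plus_topology (Iso_strong_topology james_space james_norm) james_action"
  unfolding Iso_strong_topology_def norm_topology_def continuous_map_in_subtopology
    continuous_map_componentwise
proof (intro conjI ballI)
  show "james_action ` topspace H_plus_topology \<subseteq> extensional james_space"
    by (auto simp: james_action_def)
  show "james_action \<in> topspace H_plus_topology \<rightarrow> isometries james_space james_norm"
    by (auto simp: james_action_isometry)
next
  fix f assume f: "f \<in> james_space"
  show "continuous_map H_plus_topology james.mtopology (\<lambda>g. james_action g f)"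
    unfolding james.continuous_map_to_metric
  proof (intro ballI allI impI)
    fix g and r :: real assume "g \<in> topspace H_plus_topology" "0 < r"
    then have g: "g \<in> H_plus" by simp
    obtain W where W: "openin H_plus_topology W" "g \<in> W"
      "\<And>h. h \<in> W \<Longrightarrow> james_norm (james_action g f - james_action h f) < r"
      using james_action_continuous_at[OF f g \<open>0 < r\<close>] by blast
    moreover have "W \<subseteq> H_plus" using openin_subset[OF W(1)] by simp
    ultimately show "\<exists>U. openin H_plus_topology U \<and> g \<in> U \<and>
        (\<forall>h\<in>U. james_action h f \<in> james.mball (james_action g f) r)"
      using f g by (intro exI[of _ W]) (auto simp: james_action_in james_dist)
  qed
qed

lemma james_action_inj: "inj_on james_action H_plus"
proof (rule inj_onI)
  fix g h assume gh: "g \<in> H_plus" "h \<in> H_plus" "james_action g = james_action h"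
  have "james_norm 0 = 0"
    using norm_on_james subspace_0[OF subspace_james_space] by (auto simp: norm_on_def)
  then have "h t = g t" if "t \<in> {0..1}" for t
    using uniform_dist_le_orbit_dist[OF gh(1,2) that] gh(3) by simp
  then show "g = h"
    using gh(1,2) by (intro extensionalityI[of _ "{0..1}"]) (auto simp: H_plus_def Bij_def)
qed

lemma james_action_embedding:
  "embedding_map H_plus_topology (Iso_strong_topology james_space james_norm) james_action"
proof -
  let ?T = "Iso_strong_topology james_space james_norm"
  have "openin (subtopology ?T (james_action ` H_plus)) (james_action ` W)"
    if W: "openin H_plus_topology W" for W
  proof (subst openin_subopen, intro ballI)
    fix y assume "y \<in> james_action ` W"
    then obtain g where g: "g \<in> W" "y = james_action g" by blast
    have WH: "W \<subseteq> H_plus" using openin_subset[OF W] by simp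
    then have gH: "g \<in> H_plus" using g by blast
    obtain \<epsilon> where "0 < \<epsilon>"
      and \<epsilon>: "\<And>h. h \<in> H_plus \<Longrightarrow> (\<And>t. t \<in> {0..1} \<Longrightarrow> \<bar>h t - g t\<bar> < \<epsilon>) \<Longrightarrow> h \<in> W"
      using H_plus_open_contains_uniform_ball[OF W g(1)] by blast
    define v where "v = homeo_vector g"
    have v: "v \<in> james_space"
      unfolding v_def by (intro homeo_vector_in H_plus_increasing_homeo gH)
    define O' where "O' = {T \<in> isometries james_space james_norm. T v \<in> james.mball (james_action g v) \<epsilon>}"
    have "h \<in> W" if "h \<in> H_plus" "james_action h \<in> O'" for h
    proof (rule \<epsilon>[OF that(1)])
      fix t :: real assume "t \<in> {0..1}"
      then have "\<bar>h t - g t\<bar> \<le> james_norm (james_action g v - james_action h v)"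
        unfolding v_def by (rule uniform_dist_le_orbit_dist[OF gH that(1)])
      also have "\<dots> < \<epsilon>"
        using that(2) by (auto simp: O'_def james_dist)
      finally show "\<bar>h t - g t\<bar> < \<epsilon>" .
    qed
    then have "james_action ` H_plus \<inter> O' \<subseteq> james_action ` W" by blast
    moreover have "y \<in> james_action ` H_plus \<inter> O'"
      using g gH v \<open>0 < \<epsilon>\<close> by (auto simp: O'_def james_action_isometry james_action_in)
    moreover have "openin (subtopology ?T (james_action ` H_plus)) (james_action ` H_plus \<inter> O')"
      unfolding O'_def by (intro openin_subtopology_Int2 openin_james_strong v)
    ultimately show "\<exists>S. openin (subtopology ?T (james_action ` H_plus)) S \<and> y \<in> S \<and> S \<subseteq> james_action ` W"
      by blast
  qed
  then have "open_map H_plus_topology (subtopology ?T (james_action ` H_plus)) james_action"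
    by (simp add: open_map_def)
  moreover have "james_action ` H_plus \<subseteq> isometries james_space james_norm"
    using james_action_isometry by blast
  ultimately show ?thesis
    unfolding embedding_map_def
    by (intro bijective_open_imp_homeomorphic_map)
      (auto simp: continuous_map_in_subtopology james_action_continuous james_action_inj)
qed

theorem theorem7p8:
  shows "\<exists>(V :: (real \<Rightarrow>\<^sub>C real) set) (N :: (real \<Rightarrow>\<^sub>C real) \<Rightarrow> real).
           rosenthal_space V N \<and>
           (\<exists>h. topological_group_embedding H_plus_group H_plus_topology
                  (Iso_group V N) (Iso_strong_topology V N) h)"
  using rosenthal_james james_action_hom james_action_embedding
  unfolding topological_group_embedding_def by blast

end
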